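(* Consider the dual risk model with upward and downward jumps and randomly proportional gains described in the context, with ruin probability $R(x)$ and $\rho(s)=\int_0^\infty e^{-sx}R(x)\,dx$, $\mathrm{Re}(s)>0$. Let $p_l=p\,k_l$ ($l=1,\dots,K$), $q_h=q\,m_h$ ($h=1,\dots,L$), and for $l=1,\dots,K$ put $$g_l=\frac{p_l}{1+a_l},\quad \zeta_l(s)=\frac{s}{1+a_l},\quad F_l(s)=\frac{\mu}{\mu-\zeta_l(s)},\quad \widehat g_l=-g_l\,\rho(\mu),$$ while for $l=K+1,\dots,K+L$ put $$g_l=\frac{q_{l-K}}{1+\beta_{l-K}},\quad \zeta_l(s)=\frac{s}{1+\beta_{l-K}},\quad F_l(s)=\frac{\nu}{\nu+\zeta_l(s)},\quad \widehat g_l=\frac{g_l}{\nu}.$$ Let $L(s)=\frac{1-\phi(s)}{s}+\phi(s)\sum_{l=1}^{K+L}\widehat g_l F_l(s)$. For $i_1,\dots,i_{K+L}\ge0$ let $\zeta_{i_1,\dots,i_{K+L}}(s)=\zeta_1^{i_1}(\zeta_2^{i_2}(\cdots(\zeta_{K+L}^{i_{K+L}}(s))\cdots))$, where $\zeta_l^{m}$ is the $m$-th iterate of $\zeta_l$, and define $G_{i_1,\dots,i_{K+L}}(s)$ recursively by $G_{0,\dots,0}(s)=1$, $G_{i_1,\dots,i_{K+L}}(s)=0$ if one of the indices equals $-1$, and otherwise $$G_{i_1,\dots,i_{K+L}}(s)=\sum_{l=1}^{K+L}G_{i_1,\dots,i_l-1,\dots,i_{K+L}}(s)\,\phi\big(\zeta_{i_1,\dots,i_l-1,\dots,i_{K+L}}(s)\big)F_l\big(\zeta_{i_1,\dots,i_l-1,\dots,i_{K+L}}(s)\big),$$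 where a term whose index $i_l-1$ equals $-1$ is $0$. Then, for every $s$ with $\mathrm{Re}(s)>0$ such that $\zeta_l(\zeta_{i_1,\dots,i_{K+L}}(s))\neq\mu$ for all $l\in\{1,\dots,K\}$ and all $i_1,\dots,i_{K+L}\ge 0$, $$\rho(s)=\sum_{k=0}^{\infty}\ \sum_{i_1+\cdots+i_{K+L}=k}g_1^{i_1}\cdots g_{K+L}^{i_{K+L}}\,G_{i_1,\dots,i_{K+L}}(s)\,L(\zeta_{i_1,\dots,i_{K+L}}(s)),$$ and $\rho(\mu)$ is obtained by substituting $s=\mu$ in this identity.
   Context: Model. The surplus starts at $x>0$ and decreases at unit rate between jumps. Jump interarrival times are i.i.d. positive random variables with c.d.f. $B(\cdot)$, Laplace–Stieltjes transform $\phi(s)$ and finite mean. If the surplus just before the $i$-th jump is $u>0$, it jumps to $(1+a_l)u+C_i$ with probability $p\,k_l$, $l=1,\dots,K$, and to $[(1+\beta_h)u-D_i]^{+}=\max\{(1+\beta_h)u-D_i,0\}$ with probability $q\,m_h$, $h=1,\dots,L$, where $p,q\ge0$, $p+q=1$, $k_l,m_h\ge 0$, $\sum_{l=1}^{K}k_l=1$, $\sum_{h=1}^{L}m_h=1$, and $a_l,\beta_h>0$. The $C_i$ are i.i.d. $\exp(\mu)$, the $D_i$ are i.i.d. $\exp(\nu)$, and all these random quantities are independent. Ruin occurs when the surplus reaches $0$ (either by the continuous decrease or by a downward jump to $0$), and $R(x)$ is the probability that ruin ever occurs starting from $x$. *)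

theory Defs
  imports "HOL-Probability.Probability"
begin

(* Sequences are indexed from 0: T n, J n, C n, D n belong to the (n+1)-st jump, and T n is the
   time between the n-th and the (n+1)-st jump (T 0 being the time of the first jump).
   J n encodes the kind of that jump: a value l in {1..K} is an upward jump with gain factor 1 + a l,
   a value K + h with h in {1..L} is a downward jump with gain factor 1 + \<beta> h. *)

datatype source = Gap nat | Kind nat | Gain nat | Loss nat

fun source_rv ::
  "(nat \<Rightarrow> 'w \<Rightarrow> real) \<Rightarrow> (nat \<Rightarrow> 'w \<Rightarrow> nat) \<Rightarrow> (nat \<Rightarrow> 'w \<Rightarrow> real) \<Rightarrow> (nat \<Rightarrow> 'w \<Rightarrow> real)
    \<Rightarrow> source \<Rightarrow> 'w \<Rightarrow> real" where
  "source_rv T J C D (Gap n) = T n"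
| "source_rv T J C D (Kind n) = (\<lambda>\<omega>. real (J n \<omega>))"
| "source_rv T J C D (Gain n) = C n"
| "source_rv T J C D (Loss n) = D n"

locale dual_risk_model = prob_space M for M :: "'w measure" +
  fixes K L :: nat
    and p q :: real
    and k m :: "nat \<Rightarrow> real"
    and a \<beta> :: "nat \<Rightarrow> real"
    and \<mu> \<nu> :: real
    and B :: "real \<Rightarrow> real"
    and T :: "nat \<Rightarrow> 'w \<Rightarrow> real"
    and J :: "nat \<Rightarrow> 'w \<Rightarrow> nat"
    and C D :: "nat \<Rightarrow> 'w \<Rightarrow> real"
  assumes pq: "0 \<le> p" "0 \<le> q" "p + q = 1"
    and k_nonneg: "\<And>l. l \<in> {1..K} \<Longrightarrow> 0 \<le> k l"
    and k_sum: "(\<Sum>l=1..K. k l) = 1"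
    and m_nonneg: "\<And>h. h \<in> {1..L} \<Longrightarrow> 0 \<le> m h"
    and m_sum: "(\<Sum>h=1..L. m h) = 1"
    and a_pos: "\<And>l. l \<in> {1..K} \<Longrightarrow> 0 < a l"
    and \<beta>_pos: "\<And>h. h \<in> {1..L} \<Longrightarrow> 0 < \<beta> h"
    and \<mu>_pos: "0 < \<mu>"
    and \<nu>_pos: "0 < \<nu>"
    and indep: "indep_vars (\<lambda>_. borel) (source_rv T J C D) UNIV"
    and T_pos: "\<And>n. AE \<omega> in M. 0 < T n \<omega>"
    and T_cdf: "\<And>n. cdf (distr M borel (T n)) = B"
    and T_mean: "\<And>n. integrable M (T n)"
    and J_up: "\<And>n l. l \<in> {1..K} \<Longrightarrow> prob {\<omega> \<in> space M. J n \<omega> = l} = p * k l"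
    and J_down: "\<And>n h. h \<in> {1..L} \<Longrightarrow> prob {\<omega> \<in> space M. J n \<omega> = K + h} = q * m h"
    and C_exp: "\<And>n. distributed M lborel (C n) (exponential_density \<mu>)"
    and D_exp: "\<And>n. distributed M lborel (D n) (exponential_density \<nu>)"

definition jump :: "nat \<Rightarrow> (nat \<Rightarrow> real) \<Rightarrow> (nat \<Rightarrow> real) \<Rightarrow> nat \<Rightarrow> real \<Rightarrow> real \<Rightarrow> real \<Rightarrow> real" where
  "jump K a \<beta> j c d u =
     (if j \<le> K then (1 + a j) * u + c else max ((1 + \<beta> (j - K)) * u - d) 0)"

(* Surplus immediately after the n-th jump. The recursion is continued past ruin (where the
   value before a jump may be negative); these later values play no role in the event of ruin. *)
primrec surplus_after ::
  "nat \<Rightarrow> (nat \<Rightarrow> real) \<Rightarrow> (nat \<Rightarrow> real) \<Rightarrow> (nat \<Rightarrow> 'w \<Rightarrow> real) \<Rightarrow> (nat \<Rightarrow> 'w \<Rightarrow> nat)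
    \<Rightarrow> (nat \<Rightarrow> 'w \<Rightarrow> real) \<Rightarrow> (nat \<Rightarrow> 'w \<Rightarrow> real) \<Rightarrow> real \<Rightarrow> nat \<Rightarrow> 'w \<Rightarrow> real" where
  "surplus_after K a \<beta> T J C D x 0 \<omega> = x"
| "surplus_after K a \<beta> T J C D x (Suc n) \<omega> =
     jump K a \<beta> (J n \<omega>) (C n \<omega>) (D n \<omega>) (surplus_after K a \<beta> T J C D x n \<omega> - T n \<omega>)"

(* At time t after the n-th jump, up to and including the instant just before the next jump
   (t = T n), the surplus is surplus_after n - t. A downward jump to 0 is the case t = 0. *)
definition ruin_event ::
  "'w measure \<Rightarrow> nat \<Rightarrow> (nat \<Rightarrow> real) \<Rightarrow> (nat \<Rightarrow> real) \<Rightarrow> (nat \<Rightarrow> 'w \<Rightarrow> real) \<Rightarrow> (nat \<Rightarrow> 'w \<Rightarrow> nat)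
    \<Rightarrow> (nat \<Rightarrow> 'w \<Rightarrow> real) \<Rightarrow> (nat \<Rightarrow> 'w \<Rightarrow> real) \<Rightarrow> real \<Rightarrow> 'w set" where
  "ruin_event M K a \<beta> T J C D x =
     {\<omega> \<in> space M. \<exists>n t. 0 \<le> t \<and> t \<le> T n \<omega> \<and> surplus_after K a \<beta> T J C D x n \<omega> - t = 0}"

definition ruin_prob ::
  "'w measure \<Rightarrow> nat \<Rightarrow> (nat \<Rightarrow> real) \<Rightarrow> (nat \<Rightarrow> real) \<Rightarrow> (nat \<Rightarrow> 'w \<Rightarrow> real) \<Rightarrow> (nat \<Rightarrow> 'w \<Rightarrow> nat)
    \<Rightarrow> (nat \<Rightarrow> 'w \<Rightarrow> real) \<Rightarrow> (nat \<Rightarrow> 'w \<Rightarrow> real) \<Rightarrow> real \<Rightarrow> real" where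
  "ruin_prob M K a \<beta> T J C D x = measure M (ruin_event M K a \<beta> T J C D x)"

definition laplace_transform :: "(real \<Rightarrow> real) \<Rightarrow> complex \<Rightarrow> complex" where
  "laplace_transform f s = (LINT x:{0<..}|lborel. exp (- (s * of_real x)) * of_real (f x))"

definition laplace_stieltjes :: "(real \<Rightarrow> real) \<Rightarrow> complex \<Rightarrow> complex" where
  "laplace_stieltjes B s = (LINT t:{0..}|interval_measure B. exp (- (s * of_real t)))"

(* A multi-index (i_1, ..., i_N) is a function on nat vanishing outside {1..N}. *)
definition multi_indices :: "nat \<Rightarrow> nat \<Rightarrow> (nat \<Rightarrow> nat) set" where
  "multi_indices N n = {i. (\<forall>l. l \<notin> {1..N} \<longrightarrow> i l = 0) \<and> (\<Sum>l=1..N. i l) = n}"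

(* \<zeta>_1^{i_1} (\<zeta>_2^{i_2} ( ... \<zeta>_N^{i_N} (s) ... )) *)
definition iterate_maps ::
  "nat \<Rightarrow> (nat \<Rightarrow> complex \<Rightarrow> complex) \<Rightarrow> (nat \<Rightarrow> nat) \<Rightarrow> complex \<Rightarrow> complex" where
  "iterate_maps N \<zeta> i s = foldr (\<lambda>l. \<zeta> l ^^ i l) [1..<Suc N] s"

(* The convention G = 0 for an index -1 is the branch i l = 0 of the sum. *)
function G_coeff ::
  "nat \<Rightarrow> (complex \<Rightarrow> complex) \<Rightarrow> (nat \<Rightarrow> complex \<Rightarrow> complex) \<Rightarrow> (nat \<Rightarrow> complex \<Rightarrow> complex)
    \<Rightarrow> (nat \<Rightarrow> nat) \<Rightarrow> complex \<Rightarrow> complex" where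
  "G_coeff N \<phi> \<zeta> F i s =
     (if \<forall>l\<in>{1..N}. i l = 0 then 1
      else \<Sum>l=1..N. if i l = 0 then 0 else
             G_coeff N \<phi> \<zeta> F (i(l := i l - 1)) s
               * \<phi> (iterate_maps N \<zeta> (i(l := i l - 1)) s)
               * F l (iterate_maps N \<zeta> (i(l := i l - 1)) s))"
  by pat_completeness auto
termination
proof (relation "Wellfounded.measure (\<lambda>(N, \<phi>, \<zeta>, F, i, s). \<Sum>l=1..N. i l)", goal_cases)
  case 1
  show ?case by simp
next
  case (2 N \<phi> \<zeta> F i s l)
  then have "(\<Sum>j=1..N. (i(l := i l - 1)) j) < (\<Sum>j=1..N. i j)"
    by (intro sum_strict_mono_ex1) auto
  then show ?case by simp
qed

declare G_coeff.simps [simp del]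

end

(* Conditioning on the first jump and taking Laplace transforms gives
     rho(s) = Lambda(s) + phi(s) * sum_l g_l F_l(s) rho(zeta_l(s));
   the memorylessness of the gains C produces the term rho(mu), that of the losses D and R(0) = 1
   the term g_l / nu. Iterating n times leaves the remainder
     W_n = sum over |i| = n of g^i G_i(s) rho(zeta_i(s)).
   Write g_l = w_l v_l with the probabilities w_l of the kinds of jumps and zeta_l(s) = v_l s. Then
   g^i rho(zeta_i(s)) = w^i zeta_i(s) rho(zeta_i(s)) / s, the sum of the w^i |G_i(s)| over |i| = n is
   bounded in n because F_l(zeta_i(s)) = 1 + O(r^n) with r = max v_l < 1, and z rho(z) -> 0 as z -> 0
   because R(x) -> 0 as x -> infinity. The latter holds since every jump multiplies the surplus by at
   least 1/r, so that ruin forces sum_i (T_i + D_i) r^i >= x, and this sum has finite mean.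
   At s = mu the series is affine in the number put in place of rho(mu), and its slope is not
   positive as all factors are positive there; hence rho(mu) is its only fixed point. *)

theory Submission
  imports Defs
begin

section \<open>Iterating the functional equation\<close>

text \<open>The singularity of rho at 0 shapes the estimate. A priori only |rho(z)| <= 1 / Re z is
  known, so the factor v^i contained in g^i is used up entirely by rho(zeta_i(s)). No geometric
  decay is left over, and the remainder vanishes only because Re z * |rho(z)| tends to 0 uniformly
  in the imaginary part. Hence the coefficients must be bounded without loss: G_i(s) is a sum over
  the lattice paths from 0 to i, that is, over the words with i_l letters l. Weighted by w^i, a
  level is dominated by an average over random words with letter probabilities w_l, and only a
  product of bounds for F remains. The pole condition merely keeps each factor finite. It gives a
  uniform bound because zeta_i(s) tends to 0 as |i| grows, so that all but finitely many arguments
  are far from mu. All zeta_l are scalings and commute; this is what permits indexing by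
  multi-indices instead of words. The renewal equation is derived on the space of sample paths
  because the shift acts there, whereas the given probability space carries no shift.\<close>

lemma multi_indices_0: "multi_indices N 0 = {\<lambda>_. 0}"
  unfolding multi_indices_def by (auto simp: fun_eq_iff) (metis atLeastAtMost_iff)

lemma finite_multi_indices: "finite (multi_indices N n)"
proof -
  have "multi_indices N n \<subseteq> {i. (\<forall>l. l \<notin> {1..N} \<longrightarrow> i l = 0) \<and> (\<forall>l\<in>{1..N}. i l \<in> {..n})}"
  proof (clarsimp simp: multi_indices_def)
    fix i :: "nat \<Rightarrow> nat" and l assume "Suc 0 \<le> l" "l \<le> N"
    then show "i l \<le> (\<Sum>l=Suc 0..N. i l)" by (intro member_le_sum) auto
  qed
  moreover have "finite {i. (\<forall>l. l \<notin> {1..N} \<longrightarrow> i l = 0) \<and> (\<forall>l\<in>{1..N}. i l \<in> {..n})}"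
  proof -
    have "{i. (\<forall>l. l \<notin> {1..N} \<longrightarrow> i l = 0) \<and> (\<forall>l\<in>{1..N}. i l \<in> {..n})}
        = {i. \<forall>l. (l \<in> {1..N} \<longrightarrow> i l \<in> {..n}) \<and> (l \<notin> {1..N} \<longrightarrow> i l = 0)}" by auto
    also have "finite \<dots>" by (rule finite_set_of_finite_funs) auto
    finally show ?thesis .
  qed
  ultimately show ?thesis by (rule finite_subset)
qed

lemma sum_fun_upd_Suc:
  fixes i :: "nat \<Rightarrow> nat"
  shows "l \<in> {1..N} \<Longrightarrow> (\<Sum>j=1..N. (i(l := Suc (i l))) j) = Suc (\<Sum>j=1..N. i j)"
  by (simp add: sum.remove[of "{Suc 0..N}" l])

lemma prod_power_fun_upd_Suc:
  fixes v :: "nat \<Rightarrow> 'a::comm_monoid_mult"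
  shows "l \<in> {1..N} \<Longrightarrow> (\<Prod>j=1..N. v j ^ (i(l := Suc (i l))) j) = v l * (\<Prod>j=1..N. v j ^ i j)"
  by (simp add: prod.remove[of "{Suc 0..N}" l] mult.assoc)

text \<open>Both sides run over the edges between level n and level n + 1 of the lattice of
  multi-indices, an edge being given by its lower end and a direction l. On the left the edges are
  grouped by their upper ends, on the right by their lower ends.\<close>

lemma sum_multi_indices_Suc:
  fixes f :: "(nat \<Rightarrow> nat) \<Rightarrow> nat \<Rightarrow> 'a::comm_monoid_add"
  shows "(\<Sum>i\<in>multi_indices N (Suc n). \<Sum>l=1..N. if i l = 0 then 0 else f (i(l := i l - 1)) l)
       = (\<Sum>i\<in>multi_indices N n. \<Sum>l=1..N. f i l)"
proof -
  have "(\<Sum>i\<in>multi_indices N (Suc n). \<Sum>l=1..N. if i l = 0 then 0 else f (i(l := i l - 1)) l)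
      = (\<Sum>i\<in>multi_indices N (Suc n). \<Sum>l\<in>{l\<in>{1..N}. i l \<noteq> 0}. f (i(l := i l - 1)) l)"
    by (intro sum.cong refl sum.mono_neutral_cong_right) auto
  also have "\<dots> = (\<Sum>(i, l)\<in>(SIGMA i:multi_indices N (Suc n). {l\<in>{1..N}. i l \<noteq> 0}).
                     f (i(l := i l - 1)) l)"
    by (subst sum.Sigma) (auto simp: finite_multi_indices)
  also have "\<dots> = (\<Sum>(i, l)\<in>multi_indices N n \<times> {1..N}. f i l)"
  proof (rule sum.reindex_bij_witness[where i = "\<lambda>(i, l). (i(l := Suc (i l)), l)"
        and j = "\<lambda>(i, l). (i(l := i l - 1), l)"], goal_cases)
    case (2 x)
    obtain i l where x: "x = (i, l)" by (cases x)
    have l: "l \<in> {1..N}" and il: "i l \<noteq> 0" and i: "i \<in> multi_indices N (Suc n)"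
      using 2 x by auto
    let ?j = "i(l := i l - 1)"
    have "i = ?j(l := Suc (?j l))" using il by auto
    then have "(\<Sum>k=1..N. i k) = Suc (\<Sum>k=1..N. ?j k)"
      using sum_fun_upd_Suc[OF l, of ?j] by simp
    then show ?case using i l x by (auto simp: multi_indices_def)
  next
    case (4 x)
    obtain i l where x: "x = (i, l)" by (cases x)
    then show ?case using 4 sum_fun_upd_Suc[of l N i] by (auto simp: multi_indices_def)
  qed auto
  also have "\<dots> = (\<Sum>i\<in>multi_indices N n. \<Sum>l=1..N. f i l)"
    by (subst sum.Sigma) (auto simp: finite_multi_indices)
  finally show ?thesis .
qed

lemma iterate_maps_scaling:
  assumes "\<And>l z. l \<in> {1..N} \<Longrightarrow> \<zeta> l z = of_real (v l) * z"
  shows "iterate_maps N \<zeta> i s = of_real (\<Prod>l=1..N. v l ^ i l) * s"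
  using assms
proof (induction N arbitrary: s)
  case 0
  show ?case by (simp add: iterate_maps_def)
next
  case (Suc N)
  have pow: "(\<zeta> (Suc N) ^^ n) z = of_real (v (Suc N) ^ n) * z" for n z
    by (induction n) (auto simp: Suc.prems)
  \<comment> \<open>\<open>foldr\<close> lets the last list entry act first, so the map with the
    largest index hits \<open>s\<close> directly; this is why the induction leaves \<open>s\<close>
    arbitrary.\<close>
  have "iterate_maps (Suc N) \<zeta> i s = iterate_maps N \<zeta> i ((\<zeta> (Suc N) ^^ i (Suc N)) s)"
    by (simp add: iterate_maps_def del: upt_Suc add: upt_Suc_append)
  also have "\<dots> = of_real (\<Prod>l=1..N. v l ^ i l) * (of_real (v (Suc N) ^ i (Suc N)) * s)"
    by (subst Suc.IH) (auto simp: Suc.prems pow)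
  finally show ?case by (simp add: prod.atLeast_Suc_atMost)
qed

lemma G_coeff_0: "G_coeff N \<phi> \<zeta> F (\<lambda>_. 0) s = 1"
  by (subst G_coeff.simps) simp

lemma G_coeff_Suc:
  assumes "i \<in> multi_indices N (Suc n)"
  shows "G_coeff N \<phi> \<zeta> F i s = (\<Sum>l=1..N. if i l = 0 then 0 else
             G_coeff N \<phi> \<zeta> F (i(l := i l - 1)) s
               * \<phi> (iterate_maps N \<zeta> (i(l := i l - 1)) s)
               * F l (iterate_maps N \<zeta> (i(l := i l - 1)) s))"
proof -
  have "\<not> (\<forall>l\<in>{1..N}. i l = 0)"
  proof
    assume "\<forall>l\<in>{1..N}. i l = 0"
    then have "(\<Sum>l=1..N. i l) = 0" by simp
    then show False using assms by (simp add: multi_indices_def)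
  qed
  then show ?thesis by (subst G_coeff.simps) auto
qed

text \<open>The recursion for G collects from the predecessors of a multi-index; regrouped by edges,
  each multi-index instead passes its coefficient on to its successors. This is the shape of one
  substitution of the functional equation into the remainder.\<close>

lemma sum_multi_indices_G_coeff_Suc:
  fixes g :: "nat \<Rightarrow> complex"
  shows "(\<Sum>i\<in>multi_indices N (Suc n). (\<Prod>l=1..N. g l ^ i l) * G_coeff N \<phi> \<zeta> F i s * h i)
    = (\<Sum>i\<in>multi_indices N n. (\<Prod>l=1..N. g l ^ i l) * G_coeff N \<phi> \<zeta> F i s *
         (\<phi> (iterate_maps N \<zeta> i s) *
           (\<Sum>l=1..N. g l * F l (iterate_maps N \<zeta> i s) * h (i(l := Suc (i l))))))"
proof -
  define f where "f = (\<lambda>i l. (g l * (\<Prod>l=1..N. g l ^ i l)) *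
     (G_coeff N \<phi> \<zeta> F i s * \<phi> (iterate_maps N \<zeta> i s) * F l (iterate_maps N \<zeta> i s)) * h (i(l := Suc (i l))))"
  have "(\<Sum>i\<in>multi_indices N (Suc n). (\<Prod>l=1..N. g l ^ i l) * G_coeff N \<phi> \<zeta> F i s * h i)
      = (\<Sum>i\<in>multi_indices N (Suc n). \<Sum>l=1..N. if i l = 0 then 0 else f (i(l := i l - 1)) l)"
  proof (rule sum.cong[OF refl])
    fix i assume i: "i \<in> multi_indices N (Suc n)"
    have "(\<Prod>l=1..N. g l ^ i l) * G_coeff N \<phi> \<zeta> F i s * h i = (\<Sum>l=1..N. if i l = 0 then 0 else
             (\<Prod>l=1..N. g l ^ i l) * (G_coeff N \<phi> \<zeta> F (i(l := i l - 1)) s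
               * \<phi> (iterate_maps N \<zeta> (i(l := i l - 1)) s)
               * F l (iterate_maps N \<zeta> (i(l := i l - 1)) s)) * h i)"
      unfolding G_coeff_Suc[OF i] sum_distrib_left sum_distrib_right
      by (intro sum.cong) auto
    also have "\<dots> = (\<Sum>l=1..N. if i l = 0 then 0 else f (i(l := i l - 1)) l)"
    proof (intro sum.cong refl if_cong)
      fix l assume l: "l \<in> {1..N}" and il: "i l \<noteq> 0"
      let ?j = "i(l := i l - 1)"
      have ij: "?j(l := Suc (?j l)) = i" using il by auto
      show "(\<Prod>l=1..N. g l ^ i l) * (G_coeff N \<phi> \<zeta> F ?j s
               * \<phi> (iterate_maps N \<zeta> ?j s) * F l (iterate_maps N \<zeta> ?j s)) * h i = f ?j l"
        unfolding f_def ij prod_power_fun_upd_Suc[OF l, of g ?j, unfolded ij] by simp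
    qed
    finally show "(\<Prod>l=1..N. g l ^ i l) * G_coeff N \<phi> \<zeta> F i s * h i
       = (\<Sum>l=1..N. if i l = 0 then 0 else f (i(l := i l - 1)) l)" .
  qed
  also have "\<dots> = (\<Sum>i\<in>multi_indices N n. \<Sum>l=1..N. f i l)"
    by (rule sum_multi_indices_Suc)
  finally show ?thesis
    by (simp add: f_def sum_distrib_left sum_distrib_right mult_ac)
qed

text \<open>Solved for \<open>\<Lambda> i\<close>, the equation makes each level the difference of
  two consecutive remainders, and the sum telescopes. The unknown \<open>h\<close> is indexed by
  multi-indices rather than by points, so the commutation of the maps does not enter here.\<close>

lemma iterated_equation_partial_sums:
  fixes g :: "nat \<Rightarrow> complex"
  assumes "\<And>i. h i = \<Lambda> i + \<phi> (iterate_maps N \<zeta> i s) *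
             (\<Sum>l=1..N. g l * F l (iterate_maps N \<zeta> i s) * h (i(l := Suc (i l))))"
  shows "(\<Sum>n<m. \<Sum>i\<in>multi_indices N n. (\<Prod>l=1..N. g l ^ i l) * G_coeff N \<phi> \<zeta> F i s * \<Lambda> i)
       = h (\<lambda>_. 0) - (\<Sum>i\<in>multi_indices N m. (\<Prod>l=1..N. g l ^ i l) * G_coeff N \<phi> \<zeta> F i s * h i)"
proof (induction m)
  case 0
  show ?case by (simp add: multi_indices_0 G_coeff_0)
next
  case (Suc m)
  let ?c = "\<lambda>i. (\<Prod>l=1..N. g l ^ i l) * G_coeff N \<phi> \<zeta> F i s"
  have "(\<Sum>i\<in>multi_indices N m. ?c i * \<Lambda> i) =
     (\<Sum>i\<in>multi_indices N m. ?c i * h i - ?c i * (\<phi> (iterate_maps N \<zeta> i s) *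
           (\<Sum>l=1..N. g l * F l (iterate_maps N \<zeta> i s) * h (i(l := Suc (i l))))))"
    by (intro sum.cong refl, subst assms) (simp add: algebra_simps)
  also have "\<dots> = (\<Sum>i\<in>multi_indices N m. ?c i * h i) - (\<Sum>i\<in>multi_indices N (Suc m). ?c i * h i)"
    by (simp only: sum_subtractf sum_multi_indices_G_coeff_Suc)
  finally show ?case using Suc by simp
qed

section \<open>Bounds for the coefficients G and for the factors F\<close>

text \<open>Passing from level n to n + 1 costs a factor (sum of the w_l) * b n = b n. Since the w_l
  are probabilities, the number of kinds leaves no trace in the bound.\<close>

lemma sum_weighted_norm_G_coeff_le:
  assumes w0: "\<And>l. l \<in> {1..N} \<Longrightarrow> 0 \<le> w l" and w1: "(\<Sum>l=1..N. w l) = (1::real)"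
    and \<phi>1: "\<And>i. norm (\<phi> (iterate_maps N \<zeta> i s)) \<le> 1"
    and FM: "\<And>n i l. i \<in> multi_indices N n \<Longrightarrow> l \<in> {1..N} \<Longrightarrow> norm (F l (iterate_maps N \<zeta> i s)) \<le> b n"
  shows "(\<Sum>i\<in>multi_indices N n. (\<Prod>l=1..N. w l ^ i l) * norm (G_coeff N \<phi> \<zeta> F i s)) \<le> (\<Prod>j<n. b j)"
proof (induction n)
  case 0
  show ?case by (simp add: multi_indices_0 G_coeff_0)
next
  case (Suc n)
  let ?w = "\<lambda>i. \<Prod>l=1..N. w l ^ i l"
  let ?G = "\<lambda>i. norm (G_coeff N \<phi> \<zeta> F i s)"
  define f where "f = (\<lambda>i l. w l * ?w i * ?G i * b n)"
  have N: "N \<noteq> 0" using w1 by (cases N) auto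
  \<comment> \<open>The bound \<open>b n\<close> dominates a norm as soon as level n contains a
    multi-index; the one concentrated on coordinate 1 serves, since N cannot be 0 when the weights
    sum to 1.\<close>
  have b0: "0 \<le> b n"
  proof -
    define i where "i = (\<lambda>l::nat. if l = 1 then n else 0::nat)"
    have "(\<Sum>l=1..N. i l) = n"
      unfolding i_def by (subst sum.delta) (use N in auto)
    then have "i \<in> multi_indices N n"
      using N by (auto simp: multi_indices_def i_def)
    from FM[OF this, of 1] N show ?thesis by (auto intro: order_trans[OF norm_ge_zero])
  qed
  have w_nonneg: "0 \<le> ?w i" for i by (intro prod_nonneg ballI zero_le_power w0)
  have "(\<Sum>i\<in>multi_indices N (Suc n). ?w i * ?G i)
     \<le> (\<Sum>i\<in>multi_indices N (Suc n). \<Sum>l=1..N. if i l = 0 then 0 else f (i(l := i l - 1)) l)"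
  proof (rule sum_mono)
    fix i assume i: "i \<in> multi_indices N (Suc n)"
    have "?G i \<le> (\<Sum>l=1..N. if i l = 0 then 0 else ?G (i(l := i l - 1)) * b n)"
      unfolding G_coeff_Suc[OF i]
    proof (rule sum_norm_le)
      fix l assume l: "l \<in> {1..N}"
      show "norm (if i l = 0 then 0 else
             G_coeff N \<phi> \<zeta> F (i(l := i l - 1)) s
               * \<phi> (iterate_maps N \<zeta> (i(l := i l - 1)) s)
               * F l (iterate_maps N \<zeta> (i(l := i l - 1)) s))
           \<le> (if i l = 0 then 0 else ?G (i(l := i l - 1)) * b n)"
      proof (cases "i l = 0")
        case False
        let ?j = "i(l := i l - 1)"
        have "i = ?j(l := Suc (?j l))" using False by auto
        then have "(\<Sum>k=1..N. i k) = Suc (\<Sum>k=1..N. ?j k)"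
          using sum_fun_upd_Suc[OF l, of ?j] by simp
        then have "?j \<in> multi_indices N n" using i l by (auto simp: multi_indices_def)
        then have "norm (F l (iterate_maps N \<zeta> ?j s)) \<le> b n" using l by (rule FM)
        then have "?G ?j * norm (\<phi> (iterate_maps N \<zeta> ?j s)) * norm (F l (iterate_maps N \<zeta> ?j s))
           \<le> ?G ?j * 1 * b n"
          by (intro mult_mono \<phi>1 mult_nonneg_nonneg) auto
        then show ?thesis using False by (simp add: norm_mult)
      qed simp
    qed
    then have "?w i * ?G i \<le> ?w i * (\<Sum>l=1..N. if i l = 0 then 0 else ?G (i(l := i l - 1)) * b n)"
      by (intro mult_left_mono w_nonneg)
    also have "\<dots> = (\<Sum>l=1..N. if i l = 0 then 0 else f (i(l := i l - 1)) l)"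
      unfolding sum_distrib_left
    proof (intro sum.cong refl, clarsimp)
      fix l assume l: "Suc 0 \<le> l" "l \<le> N" and il: "0 < i l"
      let ?j = "i(l := i l - Suc 0)"
      have ij: "?j(l := Suc (?j l)) = i" using il by auto
      have "(\<Prod>l=1..N. w l ^ i l) = w l * (\<Prod>l=1..N. w l ^ ?j l)"
        using prod_power_fun_upd_Suc[of l N w ?j, unfolded ij] l by simp
      then show "(\<Prod>l=Suc 0..N. w l ^ i l) * (?G ?j * b n) = f ?j l"
        unfolding f_def by simp
    qed
    finally show "?w i * ?G i \<le> (\<Sum>l=1..N. if i l = 0 then 0 else f (i(l := i l - 1)) l)" .
  qed
  also have "\<dots> = (\<Sum>i\<in>multi_indices N n. \<Sum>l=1..N. f i l)"
    by (rule sum_multi_indices_Suc)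
  also have "\<dots> = (\<Sum>l=1..N. w l) * ((\<Sum>i\<in>multi_indices N n. ?w i * ?G i) * b n)"
    unfolding f_def sum_distrib_right sum_distrib_left by (simp add: mult_ac)
  also have "\<dots> \<le> (\<Prod>j<n. b j) * b n"
    using Suc b0 unfolding w1 by (simp add: mult_right_mono)
  finally show ?case by simp
qed

lemma sum_nonneg_Reals: "(\<And>x. x \<in> A \<Longrightarrow> f x \<in> \<real>\<^sub>\<ge>\<^sub>0) \<Longrightarrow> (\<Sum>x\<in>A. f x) \<in> (\<real>\<^sub>\<ge>\<^sub>0 :: complex set)"
  by (induction A rule: infinite_finite_induct) auto

text \<open>The nonnegative reals are closed under the sums and products of the recursion. This is
  meant for s = mu, where it fixes the sign of the slope of the series in the value put for
  rho(mu).\<close>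

lemma G_coeff_nonneg_Reals:
  assumes "\<And>i. \<phi> (iterate_maps N \<zeta> i s) \<in> \<real>\<^sub>\<ge>\<^sub>0"
    and "\<And>i l. l \<in> {1..N} \<Longrightarrow> F l (iterate_maps N \<zeta> i s) \<in> \<real>\<^sub>\<ge>\<^sub>0"
  shows "i \<in> multi_indices N n \<Longrightarrow> G_coeff N \<phi> \<zeta> F i s \<in> \<real>\<^sub>\<ge>\<^sub>0"
proof (induction n arbitrary: i)
  case 0
  then show ?case by (simp add: multi_indices_0 G_coeff_0)
next
  case (Suc n)
  have "G_coeff N \<phi> \<zeta> F (i(l := i l - 1)) s \<in> \<real>\<^sub>\<ge>\<^sub>0" if "l \<in> {1..N}" "i l \<noteq> 0" for l
  proof (rule Suc.IH)
    let ?j = "i(l := i l - 1)"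
    have "i = ?j(l := Suc (?j l))" using that by auto
    then have "(\<Sum>k=1..N. i k) = Suc (\<Sum>k=1..N. ?j k)"
      using sum_fun_upd_Suc[of l N ?j] that by simp
    then show "?j \<in> multi_indices N n" using Suc.prems that by (auto simp: multi_indices_def)
  qed
  then show ?case unfolding G_coeff_Suc[OF Suc.prems]
    by (intro sum_nonneg_Reals)
       (auto intro!: nonneg_Reals_mult_I assms)
qed

lemma prod_power_multi_index_le:
  fixes v :: "nat \<Rightarrow> real"
  assumes v: "\<And>l. l \<in> {1..N} \<Longrightarrow> 0 \<le> v l" "\<And>l. l \<in> {1..N} \<Longrightarrow> v l \<le> r" and i: "i \<in> multi_indices N n"
  shows "(\<Prod>l=1..N. v l ^ i l) \<le> r ^ n"
proof -
  have "(\<Prod>l=1..N. v l ^ i l) \<le> (\<Prod>l=1..N. r ^ i l)"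
    by (intro prod_mono conjI zero_le_power power_mono v)
  also have "\<dots> = r ^ n"
    using i by (simp add: power_sum[symmetric] multi_indices_def)
  finally show ?thesis .
qed

text \<open>Raising an index inserts a map in the middle of the composition; as scalings commute, it
  can be moved to the front.\<close>

lemma iterate_maps_Suc_index:
  assumes "\<And>l z. l \<in> {1..N} \<Longrightarrow> \<zeta> l z = of_real (v l) * z" and l: "l \<in> {1..N}"
  shows "iterate_maps N \<zeta> (i(l := Suc (i l))) s = \<zeta> l (iterate_maps N \<zeta> i s)"
proof -
  have Z: "iterate_maps N \<zeta> j s = of_real (\<Prod>l=1..N. v l ^ j l) * s" for j
    by (rule iterate_maps_scaling) (rule assms(1))
  show ?thesis
    by (simp only: Z assms(1)[OF l] prod_power_fun_upd_Suc[OF l] of_real_mult mult.assoc)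
qed

text \<open>With z the argument, mu / (mu - z) = 1 + z / (mu - z), and |z| <= |s| r^n on level n. So
  a positive lower bound d for |mu - z| over all levels suffices, and c = |s| / d. The bounds 1 + c
  r^n have a convergent product.\<close>

lemma norm_pole_factors_le:
  fixes v :: "nat \<Rightarrow> real" and \<zeta> :: "nat \<Rightarrow> complex \<Rightarrow> complex"
  assumes r: "0 < r" "r < 1"
    and v: "\<And>l. l \<in> {1..N} \<Longrightarrow> 0 \<le> v l" "\<And>l. l \<in> {1..N} \<Longrightarrow> v l \<le> r"
    and \<zeta>: "\<And>l z. l \<in> {1..N} \<Longrightarrow> \<zeta> l z = of_real (v l) * z"
    and \<mu>: "0 < \<mu>" and A: "A \<subseteq> {1..N}"
    and ne: "\<And>i l. l \<in> A \<Longrightarrow> \<zeta> l (iterate_maps N \<zeta> i s) \<noteq> of_real \<mu>"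
  obtains c where "0 \<le> c" "\<And>n i l. i \<in> multi_indices N n \<Longrightarrow> l \<in> A \<Longrightarrow>
      norm (of_real \<mu> / (of_real \<mu> - \<zeta> l (iterate_maps N \<zeta> i s))) \<le> 1 + c * r ^ n"
proof -
  let ?z = "\<lambda>i l. \<zeta> l (iterate_maps N \<zeta> i s)"
  have small: "norm (?z i l) \<le> norm s * r ^ n" if i: "i \<in> multi_indices N n" and l: "l \<in> A" for n i l
  proof -
    have l': "l \<in> {1..N}" using l A by auto
    have "norm (?z i l) = v l * (\<Prod>l=1..N. v l ^ i l) * norm s"
    proof -
      have "iterate_maps N \<zeta> i s = of_real (\<Prod>l=1..N. v l ^ i l) * s"
        by (rule iterate_maps_scaling) (rule \<zeta>)
      moreover have "0 \<le> (\<Prod>l=1..N. v l ^ i l)"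
        by (intro prod_nonneg ballI zero_le_power v)
      ultimately show ?thesis
        using v(1)[OF l'] by (simp only: \<zeta>[OF l'] norm_mult norm_of_real abs_of_nonneg mult.assoc)
    qed
    also have "\<dots> \<le> 1 * r ^ n * norm s"
      using v l' r by (intro mult_right_mono mult_mono prod_power_multi_index_le[OF _ _ i] prod_nonneg) force+
    finally show ?thesis by (simp add: mult.commute)
  qed
  have "(\<lambda>n. norm s * r ^ n) \<longlonglongrightarrow> norm s * 0"
    using r by (intro tendsto_intros LIMSEQ_power_zero) auto
  then have "eventually (\<lambda>n. norm s * r ^ n < \<mu> / 2) sequentially"
    using \<mu> by (intro order_tendstoD(2)) auto
  then obtain n0 where n0: "norm s * r ^ n < \<mu> / 2" if "n0 \<le> n" for n
    unfolding eventually_sequentially by blast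
  \<comment> \<open>The finitely many distances on the levels below \<open>n0\<close>, all positive
    by the pole condition. From \<open>n0\<close> on the distance is at least \<mu> / 2, which is
    therefore inserted into the minimum below.\<close>
  define V where "V = (\<Union>n<n0. \<Union>i\<in>multi_indices N n. (\<lambda>l. norm (of_real \<mu> - ?z i l)) ` A)"
  define d where "d = Min (insert (\<mu> / 2) V)"
  have finV: "finite V"
    unfolding V_def using A finite_subset[OF A] by (auto simp: finite_multi_indices)
  have d0: "0 < d"
    unfolding d_def using finV \<mu> ne[symmetric] by (subst Min_gr_iff) (auto simp: V_def)
  have dist: "d \<le> norm (of_real \<mu> - ?z i l)" if i: "i \<in> multi_indices N n" and l: "l \<in> A" for n i l
  proof (cases "n < n0")
    case True
    then show ?thesis unfolding d_def using finV i l by (intro Min_le) (auto simp: V_def)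
  next
    case False
    have "d \<le> \<mu> / 2" unfolding d_def using finV by (intro Min_le) auto
    also have "\<dots> \<le> norm (of_real \<mu> :: complex) - norm (?z i l)"
      using small[OF i l] n0[of n] False \<mu> by simp
    also have "\<dots> \<le> norm (of_real \<mu> - ?z i l)" by (rule norm_triangle_ineq2)
    finally show ?thesis .
  qed
  show thesis
  proof (rule that[of "norm s / d"])
    show "0 \<le> norm s / d" using d0 by simp
    fix n i l assume i: "i \<in> multi_indices N n" and l: "l \<in> A"
    have nz: "of_real \<mu> - ?z i l \<noteq> 0" using ne[OF l, of i] by simp
    have "of_real \<mu> / (of_real \<mu> - ?z i l) = 1 + ?z i l / (of_real \<mu> - ?z i l)"
      using nz by (simp add: field_simps)
    then have "norm (of_real \<mu> / (of_real \<mu> - ?z i l)) \<le> 1 + norm (?z i l) / norm (of_real \<mu> - ?z i l)"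
      by (metis norm_divide norm_one norm_triangle_ineq)
    also have "norm (?z i l) / norm (of_real \<mu> - ?z i l) \<le> (norm s * r ^ n) / d"
      using small[OF i l] dist[OF i l] d0 r by (intro frac_le) auto
    finally show "norm (of_real \<mu> / (of_real \<mu> - ?z i l)) \<le> 1 + norm s / d * r ^ n" by simp
  qed
qed

text \<open>The equation is demanded only at the points reached from \<open>s\<close> by the maps,
  since elsewhere a factor may sit on its pole.\<close>

lemma iterated_equation_sums:
  fixes v w :: "nat \<Rightarrow> real" and \<zeta> F :: "nat \<Rightarrow> complex \<Rightarrow> complex" and \<rho> \<phi> \<Lambda> :: "complex \<Rightarrow> complex"
  assumes r: "0 < r" "r < 1"
    and v: "\<And>l. l \<in> {1..N} \<Longrightarrow> 0 < v l" "\<And>l. l \<in> {1..N} \<Longrightarrow> v l \<le> r"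
    and w: "\<And>l. l \<in> {1..N} \<Longrightarrow> 0 \<le> w l" "(\<Sum>l=1..N. w l) = 1"
    and \<zeta>: "\<And>l z. l \<in> {1..N} \<Longrightarrow> \<zeta> l z = of_real (v l) * z"
    and s: "0 < Re s"
    and \<phi>: "\<And>z. 0 < Re z \<Longrightarrow> norm (\<phi> z) \<le> 1"
    and c: "0 \<le> c"
    and F: "\<And>n i l. i \<in> multi_indices N n \<Longrightarrow> l \<in> {1..N} \<Longrightarrow> norm (F l (iterate_maps N \<zeta> i s)) \<le> 1 + c * r ^ n"
    and decay: "\<And>e. 0 < e \<Longrightarrow> \<exists>\<eta>>0. \<forall>z. 0 < Re z \<longrightarrow> Re z \<le> \<eta> \<longrightarrow> Re z * norm (\<rho> z) \<le> e"
    and eq: "\<And>i. \<rho> (iterate_maps N \<zeta> i s) = \<Lambda> (iterate_maps N \<zeta> i s) + \<phi> (iterate_maps N \<zeta> i s) *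
       (\<Sum>l=1..N. of_real (w l * v l) * F l (iterate_maps N \<zeta> i s) * \<rho> (\<zeta> l (iterate_maps N \<zeta> i s)))"
  shows "(\<lambda>n. \<Sum>i\<in>multi_indices N n. (\<Prod>l=1..N. of_real (w l * v l) ^ i l) * G_coeff N \<phi> \<zeta> F i s *
           \<Lambda> (iterate_maps N \<zeta> i s)) sums \<rho> s"
proof -
  let ?Z = "\<lambda>i. iterate_maps N \<zeta> i s"
  let ?G = "\<lambda>i. G_coeff N \<phi> \<zeta> F i s"
  let ?v = "\<lambda>i. \<Prod>l=1..N. v l ^ i l" and ?w = "\<lambda>i. \<Prod>l=1..N. w l ^ i l"
  let ?W = "\<lambda>n. \<Sum>i\<in>multi_indices N n. (\<Prod>l=1..N. of_real (w l * v l) ^ i l) * ?G i * \<rho> (?Z i)"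
  have Z: "?Z i = of_real (?v i) * s" for i
    by (rule iterate_maps_scaling) (rule \<zeta>)
  have v0: "0 < ?v i" for i by (intro prod_pos ballI zero_less_power v)
  have w0: "0 \<le> ?w i" for i by (intro prod_nonneg ballI zero_le_power w)
  have ReZ: "Re (?Z i) = ?v i * Re s" for i by (subst Z) (simp del: of_real_prod)
  have ReZ0: "0 < Re (?Z i)" for i using v0[of i] s unfolding ReZ by simp
  have G_sum: "(\<Sum>i\<in>multi_indices N n. ?w i * norm (?G i)) \<le> exp (c / (1 - r))" for n
  proof -
    have "(\<Sum>i\<in>multi_indices N n. ?w i * norm (?G i)) \<le> (\<Prod>j<n. 1 + c * r ^ j)"
      by (rule sum_weighted_norm_G_coeff_le) (use w \<phi> ReZ0 F in auto)
    also have "\<dots> \<le> (\<Prod>j<n. exp (c * r ^ j))"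
      by (intro prod_mono conjI exp_ge_add_one_self add_nonneg_nonneg mult_nonneg_nonneg) (use c r in auto)
    also have "\<dots> = exp (c * (\<Sum>j<n. r ^ j))" by (simp add: exp_sum sum_distrib_left)
    also have "(\<Sum>j<n. r ^ j) \<le> 1 / (1 - r)"
      using sum_le_suminf[of "\<lambda>j. r ^ j" "{..<n}"] r by (simp add: suminf_geometric summable_geometric)
    then have "exp (c * (\<Sum>j<n. r ^ j)) \<le> exp (c / (1 - r))"
      using c mult_left_mono by fastforce
    finally show ?thesis .
  qed
  have "?W \<longlonglongrightarrow> 0"
  proof (rule LIMSEQ_I)
    fix e :: real assume e: "0 < e"
    \<comment> \<open>Chosen so that the bound exp(c / (1 - r)) on the coefficients times e' / Re s
      equals e / 2.\<close>
    define e' where "e' = e * Re s / (2 * exp (c / (1 - r)))"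
    have e': "0 < e'" using e s by (simp add: e'_def)
    obtain \<eta> where \<eta>: "0 < \<eta>" "\<And>z. 0 < Re z \<Longrightarrow> Re z \<le> \<eta> \<Longrightarrow> Re z * norm (\<rho> z) \<le> e'"
      using decay[OF e'] by blast
    have "(\<lambda>n. r ^ n * Re s) \<longlonglongrightarrow> 0 * Re s"
      using r by (intro tendsto_intros LIMSEQ_power_zero) auto
    then have "eventually (\<lambda>n. r ^ n * Re s < \<eta>) sequentially"
      using \<eta>(1) by (intro order_tendstoD(2)) auto
    then obtain n0 where n0: "r ^ n * Re s < \<eta>" if "n0 \<le> n" for n
      unfolding eventually_sequentially by blast
    show "\<exists>n0. \<forall>n\<ge>n0. norm (?W n - 0) < e"
    proof (intro exI allI impI)
      fix n assume n: "n0 \<le> n"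
      have "norm (?W n) \<le> (\<Sum>i\<in>multi_indices N n. ?w i * norm (?G i) * (e' / Re s))"
      proof (rule sum_norm_le)
        fix i assume i: "i \<in> multi_indices N n"
        have "?v i \<le> r ^ n"
          using v by (intro prod_power_multi_index_le[OF _ _ i]) (auto intro: less_imp_le)
        then have "?v i * Re s \<le> r ^ n * Re s"
          using s by (intro mult_right_mono) auto
        then have "Re (?Z i) \<le> \<eta>" using n0[OF n] by (simp only: ReZ)
        \<comment> \<open>Here the part v^i of g^i is spent: it turns |rho| at the point Z_i into Re
          Z_i * |rho(Z_i)| / Re s.\<close>
        then have "?v i * Re s * norm (\<rho> (?Z i)) \<le> e'" using \<eta>(2)[OF ReZ0] by (simp only: ReZ)
        then have small: "?v i * norm (\<rho> (?Z i)) \<le> e' / Re s" using s by (simp add: field_simps)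
        have "(\<Prod>l=1..N. complex_of_real (w l * v l) ^ i l) = of_real (?w i * ?v i)"
          by (simp add: power_mult_distrib prod.distrib)
        then have "norm ((\<Prod>l=1..N. of_real (w l * v l) ^ i l) * ?G i * \<rho> (?Z i))
          = ?w i * norm (?G i) * (?v i * norm (\<rho> (?Z i)))"
          using v0[of i] w0[of i] by (simp only: norm_mult norm_of_real abs_mult) simp
        also have "\<dots> \<le> ?w i * norm (?G i) * (e' / Re s)"
          by (intro mult_left_mono small mult_nonneg_nonneg w0) auto
        finally show "norm ((\<Prod>l=1..N. of_real (w l * v l) ^ i l) * ?G i * \<rho> (?Z i)) \<le> \<dots>" .
      qed
      also have "\<dots> \<le> exp (c / (1 - r)) * (e' / Re s)"
        unfolding sum_distrib_right[symmetric] using e' s by (intro mult_right_mono G_sum) auto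
      also have "\<dots> < e" using e s by (simp add: e'_def field_simps)
      finally show "norm (?W n - 0) < e" by simp
    qed
  qed
  then have "(\<lambda>n. \<rho> s - ?W n) \<longlonglongrightarrow> \<rho> s - 0" by (intro tendsto_intros)
  moreover have "(\<Sum>n<k. \<Sum>i\<in>multi_indices N n. (\<Prod>l=1..N. of_real (w l * v l) ^ i l) * ?G i * \<Lambda> (?Z i))
      = \<rho> s - ?W k" for k
  proof -
    have "\<rho> (?Z i) = \<Lambda> (?Z i) + \<phi> (?Z i) *
       (\<Sum>l=1..N. of_real (w l * v l) * F l (?Z i) * \<rho> (?Z (i(l := Suc (i l)))))" for i
    proof -
      have "(\<Sum>l=1..N. of_real (w l * v l) * F l (?Z i) * \<rho> (\<zeta> l (?Z i)))
          = (\<Sum>l=1..N. of_real (w l * v l) * F l (?Z i) * \<rho> (?Z (i(l := Suc (i l)))))"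
      proof (rule sum.cong[OF refl])
        fix l assume l: "l \<in> {1..N}"
        have "?Z (i(l := Suc (i l))) = \<zeta> l (?Z i)"
          by (rule iterate_maps_Suc_index[of N \<zeta> v]) (use \<zeta> l in auto)
        then show "of_real (w l * v l) * F l (?Z i) * \<rho> (\<zeta> l (?Z i))
          = of_real (w l * v l) * F l (?Z i) * \<rho> (?Z (i(l := Suc (i l))))" by simp
      qed
      then show ?thesis using eq[of i] by (simp only:)
    qed
    from iterated_equation_partial_sums[of "\<lambda>i. \<rho> (?Z i)", OF this, of k]
    show ?thesis by (simp add: Z)
  qed
  ultimately show ?thesis by (simp add: sums_def)
qed

section \<open>Laplace transforms\<close>

lemma norm_exp_neg: "norm (exp (- (s * complex_of_real x))) = exp (- (Re s * x))"
  by simp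

lemma
  assumes s: "0 < Re s"
  shows set_integrable_exp: "set_integrable lborel {0<..} (\<lambda>x. exp (- (s * complex_of_real x)))"
    and laplace_transform_1: "laplace_transform (\<lambda>_. 1) s = 1 / s"
proof -
  have lim: "((\<lambda>x. exp (- (Re s * x))) \<longlongrightarrow> 0) at_top"
    using s by real_asymp
  have "set_integrable lborel (einterval 0 \<infinity>) (\<lambda>x. exp (- (Re s * x)))"
  proof (rule interval_integral_FTC_nonneg[where F = "\<lambda>x. - exp (- (Re s * x)) / Re s" and A = "- 1 / Re s" and B = 0])
    show "(((\<lambda>x. - exp (- (Re s * x)) / Re s) \<circ> real_of_ereal) \<longlongrightarrow> - 1 / Re s) (at_right 0)"
      unfolding zero_ereal_def ereal_tendsto_simps using s by (auto intro!: tendsto_eq_intros)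
    show "(((\<lambda>x. - exp (- (Re s * x)) / Re s) \<circ> real_of_ereal) \<longlongrightarrow> 0) (at_left \<infinity>)"
      unfolding ereal_tendsto_simps using s by real_asymp
  qed (use s in \<open>auto intro!: derivative_eq_intros continuous_intros\<close>)
  then have "set_integrable lborel {0<..} (\<lambda>x. exp (- (Re s * x)))"
    by (simp add: zero_ereal_def)
  then show int: "set_integrable lborel {0<..} (\<lambda>x. exp (- (s * complex_of_real x)))"
    by (rule set_integrable_bound) (auto simp: set_borel_measurable_def)
  have "(LBINT x=0..\<infinity>. exp (- (s * complex_of_real x))) = 0 - (- 1 / s)"
  proof (rule interval_integral_FTC_integrable[where F = "\<lambda>x. - exp (- (s * complex_of_real x)) / s"])
    fix x :: real
    show "((\<lambda>x. - exp (- (s * complex_of_real x)) / s) has_vector_derivative exp (- (s * complex_of_real x))) (at x)"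
      using s by (auto intro!: derivative_eq_intros has_vector_derivative_real_field)
    show "(((\<lambda>x. - exp (- (s * complex_of_real x)) / s) \<circ> real_of_ereal) \<longlongrightarrow> - 1 / s) (at_right 0)"
      unfolding zero_ereal_def ereal_tendsto_simps using s by (auto intro!: tendsto_eq_intros)
    have "((\<lambda>x. norm (- exp (- (s * complex_of_real x)) / s)) \<longlongrightarrow> 0 / norm s) at_top"
      unfolding norm_divide norm_minus_cancel norm_exp_neg
      by (rule tendsto_divide[OF lim]) (use s in auto)
    then show "(((\<lambda>x. - exp (- (s * complex_of_real x)) / s) \<circ> real_of_ereal) \<longlongrightarrow> 0) (at_left \<infinity>)"
      unfolding ereal_tendsto_simps by (auto intro: tendsto_norm_zero_cancel)
  qed (use int in \<open>auto simp: zero_ereal_def\<close>)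
  then show "laplace_transform (\<lambda>_. 1) s = 1 / s"
    by (simp add: laplace_transform_def interval_lebesgue_integral_def zero_ereal_def)
qed

lemma set_integrable_laplace:
  assumes s: "0 < Re s" and [measurable]: "f \<in> borel_measurable borel"
    and f: "\<And>x. 0 < x \<Longrightarrow> \<bar>f x\<bar> \<le> 1"
  shows "set_integrable lborel {0<..} (\<lambda>x. exp (- (s * complex_of_real x)) * of_real (f x))"
  by (rule set_integrable_bound[OF set_integrable_exp[OF s]])
     (auto simp: set_borel_measurable_def norm_mult intro!: AE_I2 mult_left_le f)

lemma laplace_transform_Re:
  assumes s: "0 < s"
  shows "(LINT x:{0<..}|lborel. exp (- (s * x)) * f x) = Re (laplace_transform f (of_real s))"
proof -
  have "laplace_transform f (of_real s) = of_real (LINT x:{0<..}|lborel. exp (- (s * x)) * f x)"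
    unfolding laplace_transform_def set_lebesgue_integral_def integral_complex_of_real[symmetric]
    by (intro Bochner_Integration.integral_cong refl)
       (simp add: scaleR_conv_of_real exp_of_real[symmetric])
  then show ?thesis by simp
qed

lemma set_integrable_laplace_real:
  assumes s: "0 < (s::real)" and [measurable]: "f \<in> borel_measurable borel"
    and f: "\<And>x. 0 < x \<Longrightarrow> \<bar>f x\<bar> \<le> 1"
  shows "set_integrable lborel {0<..} (\<lambda>x. exp (- (s * x)) * f x)"
proof -
  have "set_integrable lborel {0<..} (\<lambda>x. exp (- (complex_of_real s * complex_of_real x)) * of_real (f x))"
    by (rule set_integrable_laplace) (use s f in auto)
  then show ?thesis
    by (rule set_integrable_bound) (auto simp: set_borel_measurable_def norm_mult abs_mult)
qed

lemma norm_laplace_transform_le: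
  assumes s: "0 < Re s" and [measurable]: "f \<in> borel_measurable borel" "h \<in> borel_measurable borel"
    and f: "\<And>x. 0 < x \<Longrightarrow> \<bar>f x\<bar> \<le> h x" and h: "\<And>x. 0 < x \<Longrightarrow> h x \<le> 1"
  shows "norm (laplace_transform f s) \<le> (LINT x:{0<..}|lborel. exp (- (Re s * x)) * h x)"
  unfolding laplace_transform_def set_lebesgue_integral_def
proof (rule Bochner_Integration.integral_norm_bound_integral)
  have h0: "0 < x \<Longrightarrow> \<bar>h x\<bar> \<le> 1" for x using f[of x] h[of x] by linarith
  show "integrable lborel (\<lambda>x. indicat_real {0<..} x *\<^sub>R (exp (- (s * complex_of_real x)) * complex_of_real (f x)))"
    using set_integrable_laplace[OF s, of f] order_trans[OF f h] by (simp add: set_integrable_def)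
  show "integrable lborel (\<lambda>x. indicat_real {0<..} x *\<^sub>R (exp (- (Re s * x)) * h x))"
    using set_integrable_laplace_real[OF s, of h] h0 by (simp add: set_integrable_def)
qed (auto simp: norm_mult indicator_def f)

lemma norm_laplace_transform_le_1:
  assumes s: "0 < Re s" and [measurable]: "f \<in> borel_measurable borel"
    and f: "\<And>x. 0 < x \<Longrightarrow> \<bar>f x\<bar> \<le> 1"
  shows "norm (laplace_transform f s) \<le> 1 / Re s"
proof -
  have "norm (laplace_transform f s) \<le> (LINT x:{0<..}|lborel. exp (- (Re s * x)) * 1)"
    using s f by (intro norm_laplace_transform_le) auto
  also have "\<dots> = Re (laplace_transform (\<lambda>_. 1) (of_real (Re s)))"
    by (rule laplace_transform_Re[OF s])
  also have "\<dots> = 1 / Re s" using s by (simp add: laplace_transform_1)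
  finally show ?thesis .
qed

lemma laplace_transform_cong:
  "(\<And>x. 0 < x \<Longrightarrow> f x = h x) \<Longrightarrow> laplace_transform f s = laplace_transform h s"
  unfolding laplace_transform_def by (intro set_lebesgue_integral_cong) auto

lemma laplace_transform_scale:
  assumes "0 < c"
  shows "laplace_transform (\<lambda>x. f (c * x)) s = laplace_transform f (s / of_real c) / of_real c"
proof -
  have "laplace_transform f (s / of_real c) = of_real c * laplace_transform (\<lambda>x. f (c * x)) s"
    unfolding laplace_transform_def set_lebesgue_integral_def
    by (subst lborel_integral_real_affine[where c = c and t = 0])
       (use assms in \<open>auto simp: scaleR_conv_of_real indicator_def zero_less_mult_iff intro!: Bochner_Integration.integral_cong\<close>)
  then show ?thesis using assms by simp
qed

text \<open>This pattern occurs twice: ruin during a waiting time t, with a fresh start afterwards,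
  and a loss t, which leads to the value 1 at surplus 0 when it exceeds the surplus.\<close>

lemma laplace_transform_delay:
  assumes s: "0 < Re s" and t: "0 \<le> t" and [measurable]: "f \<in> borel_measurable borel"
    and f: "\<And>x. 0 < x \<Longrightarrow> \<bar>f x\<bar> \<le> 1"
  shows "laplace_transform (\<lambda>x. if x \<le> t then 1 else f (x - t)) s
       = (1 - exp (- (s * of_real t))) / s + exp (- (s * of_real t)) * laplace_transform f s"
proof -
  let ?h = "\<lambda>x. if x \<le> t then 1 else f (x - t)"
  \<comment> \<open>After subtracting the constant 1 the function vanishes up to \<open>t\<close>
    and is a translate of f - 1 beyond, so a single shift of the variable evaluates the
    integral.\<close>
  have "laplace_transform ?h s - laplace_transform (\<lambda>_. 1) s
      = (LINT x:{0<..}|lborel. exp (- (s * of_real x)) * of_real (?h x) - exp (- (s * of_real x)) * of_real 1)"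
    unfolding laplace_transform_def using f s
    by (intro set_integral_diff(2)[symmetric] set_integrable_laplace) auto
  also have "\<dots> = (LINT x:{0<..}|lborel. exp (- (s * of_real t)) * (exp (- (s * of_real x)) * of_real (f x) - exp (- (s * of_real x)) * of_real 1))"
    unfolding set_lebesgue_integral_def
    by (subst lborel_integral_real_affine[where c = 1 and t = t])
       (use t in \<open>auto simp: indicator_def algebra_simps exp_add[symmetric] intro!: Bochner_Integration.integral_cong\<close>)
  also have "\<dots> = exp (- (s * of_real t)) * (laplace_transform f s - laplace_transform (\<lambda>_. 1) s)"
    unfolding laplace_transform_def set_integral_mult_right
    by (subst set_integral_diff(2)) (use f s in \<open>auto intro!: set_integrable_laplace[of s "\<lambda>_. 1", simplified] set_integrable_laplace\<close>)
  finally show ?thesis using s by (simp add: laplace_transform_1 algebra_simps diff_divide_distrib)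
qed

lemma (in prob_space) laplace_transform_expectation:
  assumes s: "0 < Re s"
    and [measurable]: "case_prod f \<in> borel_measurable (borel \<Otimes>\<^sub>M M)"
    and f: "\<And>x \<omega>. \<bar>f x \<omega>\<bar> \<le> 1"
  shows "laplace_transform (\<lambda>x. expectation (f x)) s = (\<integral>\<omega>. laplace_transform (\<lambda>x. f x \<omega>) s \<partial>M)"
proof -
  interpret P: pair_sigma_finite lborel M ..
  let ?h = "\<lambda>x \<omega>. indicat_real {0<..} x *\<^sub>R (exp (- (s * complex_of_real x)) * of_real (f x \<omega>))"
  have fm[measurable]: "(\<lambda>\<omega>. f x \<omega>) \<in> borel_measurable M" for x
    by measurable
  have fi: "integrable M (f x)" for x
    by (rule integrable_const_bound[where B = 1]) (auto simp: f)
  have "integrable (lborel \<Otimes>\<^sub>M M) (case_prod ?h)"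
  proof (rule P.Fubini_integrable)
    show "case_prod ?h \<in> borel_measurable (lborel \<Otimes>\<^sub>M M)" by measurable
    have "set_integrable lborel {0<..} (\<lambda>x. exp (- (Re s * x)) * expectation (\<lambda>\<omega>. \<bar>f x \<omega>\<bar>))"
    proof (rule set_integrable_laplace_real)
      fix x
      have "expectation (\<lambda>\<omega>. \<bar>f x \<omega>\<bar>) \<le> expectation (\<lambda>\<omega>. 1)"
        by (rule integral_mono) (auto simp: f intro: integrable_abs fi)
      then show "\<bar>expectation (\<lambda>\<omega>. \<bar>f x \<omega>\<bar>)\<bar> \<le> 1" by (simp add: prob_space)
    qed (use s in auto)
    then show "integrable lborel (\<lambda>x. \<integral>y. norm (case_prod ?h (x, y)) \<partial>M)"
      by (simp add: set_integrable_def norm_mult mult.assoc)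
    show "AE x in lborel. integrable M (\<lambda>y. case_prod ?h (x, y))"
      by (auto intro!: integrable_mult_right integrable_scaleR_right integrable_of_real fi)
  qed
  then have "(\<integral>\<omega>. (\<integral>x. ?h x \<omega> \<partial>lborel) \<partial>M) = (\<integral>x. (\<integral>\<omega>. ?h x \<omega> \<partial>M) \<partial>lborel)"
    by (rule P.Fubini_integral)
  then show ?thesis
    by (simp add: laplace_transform_def set_lebesgue_integral_def)
qed

section \<open>Averaging over exponential losses and gains\<close>

lemma AE_exponential_nonneg:
  assumes D: "distributed M lborel D (exponential_density \<nu>)"
  shows "AE \<omega> in M. 0 \<le> D \<omega>"
proof -
  have [measurable]: "D \<in> borel_measurable M"
    using distributed_measurable[OF D] by simp
  have "AE x in distr M lborel D. 0 \<le> x"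
    unfolding distributed_distr_eq_density[OF D]
    by (subst AE_density) (auto simp: exponential_density_def)
  then show ?thesis by (rule AE_distrD[rotated]) simp
qed

lemma integral_exponential:
  fixes h :: "real \<Rightarrow> complex"
  assumes "prob_space M" and D: "distributed M lborel D (exponential_density \<nu>)" and \<nu>: "0 < \<nu>"
    and [measurable]: "h \<in> borel_measurable borel"
  shows "(\<integral>\<omega>. h (D \<omega>) \<partial>M) = (LINT x:{0<..}|lborel. of_real (\<nu> * exp (- (\<nu> * x))) * h x)"
proof -
  have [measurable]: "D \<in> borel_measurable M"
    using distributed_measurable[OF D] by simp
  have "(\<integral>\<omega>. h (D \<omega>) \<partial>M) = (\<integral>x. h x \<partial>distr M lborel D)"
    by (simp add: integral_distr)
  also have "\<dots> = (\<integral>x. exponential_density \<nu> x *\<^sub>R h x \<partial>lborel)"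
    unfolding distributed_distr_eq_density[OF D]
    by (rule integral_density) (use \<nu> in auto)
  also have "\<dots> = (LINT x:{0<..}|lborel. of_real (\<nu> * exp (- (\<nu> * x))) * h x)"
    unfolding set_lebesgue_integral_def
    by (intro integral_cong_AE)
       (use AE_lborel_singleton[of 0] in \<open>auto simp: exponential_density_def scaleR_conv_of_real indicator_def mult_ac elim!: eventually_mono\<close>)
  finally show ?thesis .
qed

lemma integral_exp_exponential:
  assumes "prob_space M" "distributed M lborel D (exponential_density \<nu>)" "0 < \<nu>" and s: "0 \<le> Re s"
  shows "(\<integral>\<omega>. exp (- (s * of_real (D \<omega>))) \<partial>M) = of_real \<nu> / (of_real \<nu> + s)"
proof -
  have "(\<integral>\<omega>. exp (- (s * of_real (D \<omega>))) \<partial>M)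
      = (LINT x:{0<..}|lborel. of_real (\<nu> * exp (- (\<nu> * x))) * exp (- (s * of_real x)))"
    using integral_exponential[OF assms(1-3), of "\<lambda>x. exp (- (s * of_real x))"] by simp
  also have "\<dots> = (LINT x:{0<..}|lborel. of_real \<nu> * exp (- ((of_real \<nu> + s) * of_real x)))"
    by (simp add: exp_of_real[symmetric] exp_add[symmetric] mult.assoc algebra_simps)
  also have "\<dots> = of_real \<nu> * laplace_transform (\<lambda>_. 1) (of_real \<nu> + s)"
    by (simp add: laplace_transform_def)
  also have "\<dots> = of_real \<nu> / (of_real \<nu> + s)"
    using assms by (subst laplace_transform_1) auto
  finally show ?thesis .
qed

text \<open>For a fixed loss d the function is \<open>f\<close> delayed by d, with the value f 0 = 1
  during the delay. Averaging turns exp(-s d) into \<nu> / (\<nu> + s), and the constant part is (1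
  - \<nu> / (\<nu> + s)) / s = 1 / (\<nu> + s).\<close>

lemma integral_laplace_exponential_loss:
  assumes M: "prob_space M" and D: "distributed M lborel D (exponential_density \<nu>)" and \<nu>: "0 < \<nu>"
    and s: "0 < Re s"
    and f[measurable]: "f \<in> borel_measurable borel" and f1: "\<And>x. \<bar>f x\<bar> \<le> 1" and f0: "f 0 = 1"
  shows "(\<integral>\<omega>. laplace_transform (\<lambda>u. f (max (u - D \<omega>) 0)) s \<partial>M)
       = of_real \<nu> / (of_real \<nu> + s) * (laplace_transform f s + 1 / of_real \<nu>)"
proof -
  interpret prob_space M by fact
  have [measurable]: "D \<in> borel_measurable M"
    using distributed_measurable[OF D] by simp
  have D0: "AE \<omega> in M. 0 \<le> D \<omega>"
    by (rule AE_exponential_nonneg[OF D])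
  have eq: "laplace_transform (\<lambda>u. f (max (u - d) 0)) s
      = (1 - exp (- (s * of_real d))) / s + exp (- (s * of_real d)) * laplace_transform f s" if "0 \<le> d" for d
  proof -
    have "laplace_transform (\<lambda>u. f (max (u - d) 0)) s = laplace_transform (\<lambda>u. if u \<le> d then 1 else f (u - d)) s"
      by (rule laplace_transform_cong) (auto simp: f0 max_def)
    then show ?thesis using laplace_transform_delay[OF s that f] f1 by simp
  qed
  have int: "integrable M (\<lambda>\<omega>. exp (- (s * of_real (D \<omega>))))"
    by (rule integrable_const_bound[where B = 1]) (use D0 s in \<open>auto elim!: eventually_mono\<close>)
  have "(\<integral>\<omega>. laplace_transform (\<lambda>u. f (max (u - D \<omega>) 0)) s \<partial>M)
      = (\<integral>\<omega>. 1 / s + exp (- (s * of_real (D \<omega>))) * (laplace_transform f s - 1 / s) \<partial>M)"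
  proof (rule integral_cong_AE)
    show "(\<lambda>\<omega>. laplace_transform (\<lambda>u. f (max (u - D \<omega>) 0)) s) \<in> borel_measurable M"
      unfolding laplace_transform_def set_lebesgue_integral_def by measurable
    show "AE \<omega> in M. laplace_transform (\<lambda>u. f (max (u - D \<omega>) 0)) s
       = 1 / s + exp (- (s * of_real (D \<omega>))) * (laplace_transform f s - 1 / s)"
      using D0 by eventually_elim (simp add: eq algebra_simps diff_divide_distrib)
  qed measurable
  also have "\<dots> = 1 / s + of_real \<nu> / (of_real \<nu> + s) * (laplace_transform f s - 1 / s)"
    using int integral_exp_exponential[OF M D \<nu>, of s] s by (simp add: prob_space)
  also have "\<dots> = of_real \<nu> / (of_real \<nu> + s) * (laplace_transform f s + 1 / of_real \<nu>)"
  proof -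
    have "s \<noteq> 0" "of_real \<nu> + s \<noteq> 0" "of_real \<nu> \<noteq> (0::complex)"
      using s \<nu> by (auto simp: complex_eq_iff)
    then show ?thesis by (simp add: divide_simps) (simp add: algebra_simps)
  qed
  finally show ?thesis .
qed

text \<open>A convolution of two exponentials, evaluated by partial fractions. The summand in z
  leads to the transform at z and the one in \<mu> to the unknown constant rho(\<mu>); the two merge
  when z = \<mu>.\<close>

lemma integral_exponential_convolution:
  fixes z :: complex
  assumes M: "prob_space M" and C: "distributed M lborel C (exponential_density \<mu>)" and \<mu>: "0 < \<mu>"
    and z: "z \<noteq> of_real \<mu>" and y: "0 < y"
  shows "(\<integral>\<omega>. (if 0 \<le> C \<omega> \<and> C \<omega> < y then exp (- (z * of_real (y - C \<omega>))) else 0) \<partial>M)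
       = of_real \<mu> / (of_real \<mu> - z) * (exp (- (z * of_real y)) - exp (- (of_real \<mu> * of_real y)))"
proof -
  let ?e = "\<lambda>x. of_real \<mu> * exp (- (z * of_real y) + (z - of_real \<mu>) * of_real x)"
  have "(\<integral>\<omega>. (if 0 \<le> C \<omega> \<and> C \<omega> < y then exp (- (z * of_real (y - C \<omega>))) else 0) \<partial>M)
      = (LINT x:{0<..}|lborel. of_real (\<mu> * exp (- (\<mu> * x))) *
            (if 0 \<le> x \<and> x < y then exp (- (z * of_real (y - x))) else 0))"
    by (rule integral_exponential[OF M C \<mu>]) measurable
  also have "\<dots> = (\<integral>x. indicator {0..y} x *\<^sub>R ?e x \<partial>lborel)"
    unfolding set_lebesgue_integral_def
    by (intro integral_cong_AE)
       (use AE_lborel_singleton[of 0] AE_lborel_singleton[of y] in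
         \<open>auto elim!: eventually_elim2 simp: indicator_def exp_of_real[symmetric] exp_add[symmetric] algebra_simps\<close>)
  also have "\<dots> = (of_real \<mu> / (z - of_real \<mu>) * exp (- (z * of_real y) + (z - of_real \<mu>) * of_real y))
      - (of_real \<mu> / (z - of_real \<mu>) * exp (- (z * of_real y) + (z - of_real \<mu>) * of_real 0))"
    by (rule integral_FTC_atLeastAtMost)
       (use z y in \<open>auto intro!: derivative_eq_intros has_vector_derivative_real_field continuous_intros\<close>)
  also have "\<dots> = of_real \<mu> / (of_real \<mu> - z) * (exp (- (z * of_real y)) - exp (- (of_real \<mu> * of_real y)))"
    using z by (simp add: divide_simps) (simp add: algebra_simps)
  finally show ?thesis .
qed

text \<open>The substitution y = u + C frees \<open>f\<close> of the random gain, which then occurs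
  only in an explicit kernel; Fubini averages the kernel before the integration over y.\<close>

lemma integral_laplace_exponential_gain:
  assumes M: "prob_space M" and C: "distributed M lborel C (exponential_density \<mu>)" and \<mu>: "0 < \<mu>"
    and z: "0 < Re z" "z \<noteq> of_real \<mu>"
    and [measurable]: "f \<in> borel_measurable borel" and f1: "\<And>x. \<bar>f x\<bar> \<le> 1"
  shows "(\<integral>\<omega>. laplace_transform (\<lambda>u. f (u + C \<omega>)) z \<partial>M)
       = of_real \<mu> / (of_real \<mu> - z) * (laplace_transform f z - laplace_transform f (of_real \<mu>))"
proof -
  interpret prob_space M by fact
  interpret P: pair_sigma_finite M lborel ..
  have [measurable]: "C \<in> borel_measurable M"
    using distributed_measurable[OF C] by simp
  have C0: "AE \<omega> in M. 0 \<le> C \<omega>"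
    by (rule AE_exponential_nonneg[OF C])
  \<comment> \<open>The condition \<open>0 \<le> c\<close> holds almost surely for the gain; built
    into the kernel it makes the kernel vanish for all y <= 0, so that y may range over the whole
    line.\<close>
  let ?k = "\<lambda>c y. (if 0 \<le> c \<and> c < y then exp (- (z * of_real (y - c))) else 0) * complex_of_real (f y)"
  have eq: "laplace_transform (\<lambda>u. f (u + c)) z = (\<integral>y. ?k c y \<partial>lborel)" if "0 \<le> c" for c
    unfolding laplace_transform_def set_lebesgue_integral_def
    by (subst (2) lborel_integral_real_affine[where c = 1 and t = c])
       (use that in \<open>auto simp: indicator_def algebra_simps intro!: Bochner_Integration.integral_cong\<close>)
  have eq_norm: "(\<integral>y. norm (?k c y) \<partial>lborel) = (LINT u:{0<..}|lborel. exp (- (Re z * u)) * \<bar>f (u + c)\<bar>)"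
    if "0 \<le> c" for c
    unfolding set_lebesgue_integral_def
    by (subst lborel_integral_real_affine[where c = 1 and t = c])
       (use that in \<open>auto simp: indicator_def algebra_simps norm_mult intro!: Bochner_Integration.integral_cong\<close>)
  have le: "norm (LINT u:{0<..}|lborel. exp (- (Re z * u)) * \<bar>f (u + c)\<bar>) \<le> 1 / Re z" for c
  proof -
    have "norm (LINT u:{0<..}|lborel. exp (- (Re z * u)) * \<bar>f (u + c)\<bar>)
       = norm (Re (laplace_transform (\<lambda>u. \<bar>f (u + c)\<bar>) (of_real (Re z))))"
      by (subst laplace_transform_Re) (use z in auto)
    also have "\<dots> \<le> norm (laplace_transform (\<lambda>u. \<bar>f (u + c)\<bar>) (of_real (Re z)))"
      using abs_Re_le_cmod by simp
    also have "\<dots> \<le> 1 / Re (complex_of_real (Re z))"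
      by (rule norm_laplace_transform_le_1) (use z f1 in auto)
    finally show ?thesis by simp
  qed
  have km: "(\<lambda>(\<omega>, y). ?k (C \<omega>) y) \<in> borel_measurable (M \<Otimes>\<^sub>M lborel)" by measurable
  have int: "integrable (M \<Otimes>\<^sub>M lborel) (\<lambda>(\<omega>, y). ?k (C \<omega>) y)"
  proof (rule P.Fubini_integrable[OF km])
    show "integrable M (\<lambda>\<omega>. \<integral>y. norm (case (\<omega>, y) of (\<omega>, y) \<Rightarrow> ?k (C \<omega>) y) \<partial>lborel)"
    proof (rule integrable_const_bound[where B = "1 / Re z"])
      show "AE \<omega> in M. norm (\<integral>y. norm (case (\<omega>, y) of (\<omega>, y) \<Rightarrow> ?k (C \<omega>) y) \<partial>lborel) \<le> 1 / Re z"
        using C0 by eventually_elim (use eq_norm le in simp)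
    qed measurable
    have *: "integrable lborel (?k c)" if "0 \<le> c" for c
    proof -
      have "set_integrable lborel {0<..} (\<lambda>u. exp (- (z * of_real u)) * of_real (f (u + c)))"
        by (rule set_integrable_laplace) (use z f1 in auto)
      then have "integrable lborel (\<lambda>u. ?k c (c + 1 * u))"
        unfolding set_integrable_def
        by (rule Bochner_Integration.integrable_cong[THEN iffD1, OF refl, rotated])
           (use that in \<open>auto simp: indicator_def algebra_simps\<close>)
      then show ?thesis
        by (subst (asm) lborel_integrable_real_affine_iff) auto
    qed
    show "AE \<omega> in M. integrable lborel (\<lambda>y. case (\<omega>, y) of (\<omega>, y) \<Rightarrow> ?k (C \<omega>) y)"
      using C0 by eventually_elim (use * in simp)
  qed
  have "(\<integral>\<omega>. laplace_transform (\<lambda>u. f (u + C \<omega>)) z \<partial>M) = (\<integral>\<omega>. (\<integral>y. ?k (C \<omega>) y \<partial>lborel) \<partial>M)"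
  proof (rule integral_cong_AE)
    show "(\<lambda>\<omega>. laplace_transform (\<lambda>u. f (u + C \<omega>)) z) \<in> borel_measurable M"
      unfolding laplace_transform_def set_lebesgue_integral_def by measurable
    show "AE \<omega> in M. laplace_transform (\<lambda>u. f (u + C \<omega>)) z = (\<integral>y. ?k (C \<omega>) y \<partial>lborel)"
      using C0 by eventually_elim (rule eq)
  qed measurable
  also have "\<dots> = (\<integral>y. (\<integral>\<omega>. ?k (C \<omega>) y \<partial>M) \<partial>lborel)"
    by (rule P.Fubini_integral[OF int, symmetric])
  also have "\<dots> = (LINT y:{0<..}|lborel. of_real \<mu> / (of_real \<mu> - z) *
       (exp (- (z * of_real y)) * of_real (f y) - exp (- (of_real \<mu> * of_real y)) * of_real (f y)))"
    unfolding set_lebesgue_integral_def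
  proof (rule Bochner_Integration.integral_cong[OF refl])
    fix y :: real
    show "(\<integral>\<omega>. ?k (C \<omega>) y \<partial>M) = indicator {0<..} y *\<^sub>R (of_real \<mu> / (of_real \<mu> - z) *
       (exp (- (z * of_real y)) * of_real (f y) - exp (- (of_real \<mu> * of_real y)) * of_real (f y)))"
    proof (cases "0 < y")
      case True
      then show ?thesis
        by (simp add: integral_exponential_convolution[OF M C \<mu> z(2)] algebra_simps
            del: of_real_diff)
    next
      case False
      then have "(\<lambda>\<omega>. ?k (C \<omega>) y) = (\<lambda>_. 0)" by (auto simp: fun_eq_iff)
      then show ?thesis using False by (simp only:) simp
    qed
  qed
  also have "\<dots> = of_real \<mu> / (of_real \<mu> - z) * (laplace_transform f z - laplace_transform f (of_real \<mu>))"
    unfolding laplace_transform_def set_integral_mult_right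
    by (subst set_integral_diff(2)) (use f1 z \<mu> in \<open>auto intro!: set_integrable_laplace\<close>)
  finally show ?thesis .
qed

text \<open>Split at b: the part up to b contributes at most b because f <= 1, the tail at most (e /
  2) / Re z. Multiplied by Re z this is b * Re z + e / 2. Only Re z enters, hence the uniformity in
  the imaginary part.\<close>

lemma Re_mult_norm_laplace_transform_small:
  assumes [measurable]: "f \<in> borel_measurable borel"
    and f: "\<And>x. 0 \<le> f x" "\<And>x. f x \<le> 1" and m: "\<And>x. 0 < x \<Longrightarrow> f x \<le> m / x"
    and e: "0 < e"
  obtains \<eta> where "0 < \<eta>" "\<And>z. 0 < Re z \<Longrightarrow> Re z \<le> \<eta> \<Longrightarrow> Re z * norm (laplace_transform f z) \<le> e"
proof
  \<comment> \<open>Makes max m 1 / b equal to e / 2; the maximum keeps \<open>b\<close> positive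
    when m = 0.\<close>
  define b where "b = 2 * max m 1 / e"
  have b0: "0 < b" using e by (simp add: b_def)
  show "0 < e / (2 * b)" using e b0 by simp
  fix z assume z: "0 < Re z" "Re z \<le> e / (2 * b)"
  have tail: "f x \<le> indicator {0<..b} x + e / 2" if "0 < x" for x
  proof (cases "x \<le> b")
    case True
    then show ?thesis using f[of x] e that by simp
  next
    case False
    have "f x \<le> m / x" by (rule m[OF that])
    also have "\<dots> \<le> max m 1 / b"
      using False b0 by (intro frac_le) auto
    also have "\<dots> = e / 2" using e by (simp add: b_def field_simps)
    finally show ?thesis using False by simp
  qed
  have int_e: "set_integrable lborel {0<..} (\<lambda>x. exp (- (Re z * x)) * 1)"
    by (rule set_integrable_laplace_real) (use z in auto)
  have int_b: "set_integrable lborel {0<..} (\<lambda>x. indicator {0<..b} x :: real)"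
  proof -
    have "integrable lborel (\<lambda>x. indicator {0<..b} x :: real)"
      using b0 by (intro integrable_real_indicator) auto
    moreover have "(\<lambda>x. indicator {0<..} x *\<^sub>R indicator {0<..b} x) = (\<lambda>x. indicator {0<..b} x :: real)"
      by (auto simp: fun_eq_iff indicator_def)
    ultimately show ?thesis by (simp add: set_integrable_def)
  qed
  have "norm (laplace_transform f z) \<le> (LINT x:{0<..}|lborel. exp (- (Re z * x)) * f x)"
    by (rule norm_laplace_transform_le) (use z f in auto)
  also have "\<dots> \<le> (LINT x:{0<..}|lborel. indicator {0<..b} x + e / 2 * (exp (- (Re z * x)) * 1))"
  proof (rule set_integral_mono)
    show "set_integrable lborel {0<..} (\<lambda>x. exp (- (Re z * x)) * f x)"
      by (rule set_integrable_laplace_real) (use z f in auto)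
    show "set_integrable lborel {0<..} (\<lambda>x. indicator {0<..b} x + e / 2 * (exp (- (Re z * x)) * 1))"
      by (intro set_integral_add set_integrable_mult_right int_e int_b)
    fix x :: real assume x: "x \<in> {0<..}"
    have "exp (- (Re z * x)) * f x \<le> exp (- (Re z * x)) * (indicator {0<..b} x + e / 2)"
      using tail[of x] x by (intro mult_left_mono) auto
    also have "\<dots> \<le> indicator {0<..b} x + e / 2 * (exp (- (Re z * x)) * 1)"
      using z x by (auto simp: indicator_def algebra_simps)
    finally show "exp (- (Re z * x)) * f x \<le> \<dots>" .
  qed
  also have "\<dots> = (LINT x:{0<..}|lborel. indicator {0<..b} x) + e / 2 * (LINT x:{0<..}|lborel. exp (- (Re z * x)) * 1)"
    by (subst set_integral_add(2)) (use int_e int_b in \<open>auto intro: set_integrable_mult_right\<close>)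
  also have "(LINT x:{0<..}|lborel. indicator {0<..b} x :: real) = (\<integral>x. indicator {0<..b} x \<partial>lborel)"
    unfolding set_lebesgue_integral_def
    by (intro Bochner_Integration.integral_cong) (auto simp: indicator_def)
  also have "\<dots> = b" using b0 by simp
  also have "(LINT x:{0<..}|lborel. exp (- (Re z * x)) * 1) = Re (laplace_transform (\<lambda>_. 1) (of_real (Re z)))"
    by (rule laplace_transform_Re[OF z(1)])
  also have "\<dots> = 1 / Re z" using z by (simp add: laplace_transform_1)
  finally have "norm (laplace_transform f z) \<le> b + e / 2 * (1 / Re z)" .
  then have "Re z * norm (laplace_transform f z) \<le> Re z * (b + e / 2 * (1 / Re z))"
    using z by (intro mult_left_mono) auto
  also have "\<dots> = Re z * b + e / 2" using z by (simp add: field_simps)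
  also have "\<dots> \<le> e" using z b0 by (simp add: field_simps)
  finally show "Re z * norm (laplace_transform f z) \<le> e" .
qed

section \<open>The renewal equation\<close>

primrec next_source :: "source \<Rightarrow> source" where
  "next_source (Gap n) = Gap (Suc n)"
| "next_source (Kind n) = Kind (Suc n)"
| "next_source (Gain n) = Gain (Suc n)"
| "next_source (Loss n) = Loss (Suc n)"

text \<open>The surplus as a function of the sample path of all sources, so that the law of the paths,
  which is invariant under the shift, can be used in place of the probability space.\<close>

abbreviation path_surplus ::
  "nat \<Rightarrow> (nat \<Rightarrow> real) \<Rightarrow> (nat \<Rightarrow> real) \<Rightarrow> real \<Rightarrow> nat \<Rightarrow> (source \<Rightarrow> real) \<Rightarrow> real" where
  "path_surplus K a \<beta> \<equiv> surplus_after K a \<beta> (\<lambda>n w. w (Gap n)) (\<lambda>n w. nat \<lfloor>w (Kind n)\<rfloor>)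
     (\<lambda>n w. w (Gain n)) (\<lambda>n w. w (Loss n))"

text \<open>The time t in \<open>ruin_event\<close> is eliminated: it must equal the surplus after
  the n-th jump.\<close>

definition ruinous :: "nat \<Rightarrow> (nat \<Rightarrow> real) \<Rightarrow> (nat \<Rightarrow> real) \<Rightarrow> real \<Rightarrow> (source \<Rightarrow> real) \<Rightarrow> bool" where
  "ruinous K a \<beta> x w \<longleftrightarrow> (\<exists>n. 0 \<le> path_surplus K a \<beta> x n w \<and> path_surplus K a \<beta> x n w \<le> w (Gap n))"

definition first_jump :: "nat \<Rightarrow> (nat \<Rightarrow> real) \<Rightarrow> (nat \<Rightarrow> real) \<Rightarrow> real \<Rightarrow> (source \<Rightarrow> real) \<Rightarrow> real" where
  "first_jump K a \<beta> x w =
     jump K a \<beta> (nat \<lfloor>w (Kind 0)\<rfloor>) (w (Gain 0)) (w (Loss 0)) (x - w (Gap 0))"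

text \<open>The rounding in \<open>path_surplus\<close> recovers the kind of a jump from its
  embedding into the reals.\<close>

lemma surplus_after_eq_path_surplus:
  "surplus_after K a \<beta> T J C D x n \<omega> = path_surplus K a \<beta> x n (\<lambda>i. source_rv T J C D i \<omega>)"
  by (induction n) simp_all

text \<open>The recursion of the surplus splits off the last jump, the renewal argument the first;
  this translates between the two.\<close>

lemma path_surplus_Suc_shift:
  "path_surplus K a \<beta> x (Suc n) w = path_surplus K a \<beta> (first_jump K a \<beta> x w) n (\<lambda>i. w (next_source i))"
proof (induction n)
  case 0
  show ?case by (simp add: first_jump_def)
next
  case (Suc n)
  have "path_surplus K a \<beta> x (Suc (Suc n)) w = jump K a \<beta> (nat \<lfloor>w (Kind (Suc n))\<rfloor>) (w (Gain (Suc n)))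
     (w (Loss (Suc n))) (path_surplus K a \<beta> x (Suc n) w - w (Gap (Suc n)))"
    by (rule surplus_after.simps)
  also have "\<dots> = path_surplus K a \<beta> (first_jump K a \<beta> x w) (Suc n) (\<lambda>i. w (next_source i))"
    unfolding Suc by simp
  finally show ?case .
qed

text \<open>The continuation past ruin is harmless: whatever the shifted path does after an early
  ruin, the first alternative already holds.\<close>

lemma ruinous_unfold:
  "ruinous K a \<beta> x w \<longleftrightarrow> 0 \<le> x \<and> x \<le> w (Gap 0) \<or>
     ruinous K a \<beta> (first_jump K a \<beta> x w) (\<lambda>i. w (next_source i))"
proof -
  have ex: "(\<exists>n. P n) \<longleftrightarrow> P 0 \<or> (\<exists>n. P (Suc n))" for P
    by (metis not0_implies_Suc)
  show ?thesis
    unfolding ruinous_def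
    by (subst ex) (simp only: path_surplus_Suc_shift surplus_after.simps(1) next_source.simps)
qed

lemma mem_ruin_event_iff:
  "\<omega> \<in> ruin_event M K a \<beta> T J C D x \<longleftrightarrow>
     \<omega> \<in> space M \<and> ruinous K a \<beta> x (\<lambda>i. source_rv T J C D i \<omega>)"
  unfolding ruin_event_def ruinous_def surplus_after_eq_path_surplus[symmetric] by auto

lemma measurable_jump [measurable (raw)]:
  assumes [measurable]: "j \<in> measurable N (count_space UNIV)" "c \<in> borel_measurable N"
    "d \<in> borel_measurable N" "u \<in> borel_measurable N"
  shows "(\<lambda>z. jump K a \<beta> (j z) (c z) (d z) (u z)) \<in> borel_measurable N"
proof -
  have [measurable]: "(\<lambda>z. h (j z)) \<in> borel_measurable N" for h :: "nat \<Rightarrow> real"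
    by (rule measurable_compose[OF assms(1)]) simp
  show ?thesis unfolding jump_def by measurable
qed

text \<open>Measurability must be joint in start and path, because the renewal argument inserts a
  random start, the surplus after the first jump.\<close>

lemma measurable_path_surplus [measurable]:
  "(\<lambda>(x, w). path_surplus K a \<beta> x n w) \<in> borel_measurable (borel \<Otimes>\<^sub>M (\<Pi>\<^sub>M i\<in>UNIV. borel))"
proof (induction n)
  case 0
  show ?case by simp
next
  case (Suc n)
  note [measurable] = Suc
  show ?case unfolding surplus_after.simps by measurable
qed

lemma pred_ruinous [measurable (raw)]:
  assumes [measurable]: "f \<in> borel_measurable N" "h \<in> measurable N (\<Pi>\<^sub>M i\<in>UNIV. borel)"
  shows "Measurable.pred N (\<lambda>z. ruinous K a \<beta> (f z) (h z))"
proof -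
  have [measurable]: "(\<lambda>z. path_surplus K a \<beta> (f z) n (h z)) \<in> borel_measurable N" for n
    using measurable_compose[OF measurable_Pair[OF assms] measurable_path_surplus] by simp
  show ?thesis unfolding ruinous_def by measurable
qed

context dual_risk_model
begin

section \<open>The law of the sources and its invariance under the shift\<close>

abbreviation X :: "source \<Rightarrow> 'w \<Rightarrow> real" where "X \<equiv> source_rv T J C D"
abbreviation R :: "real \<Rightarrow> real" where "R \<equiv> ruin_prob M K a \<beta> T J C D"
abbreviation paths :: "(source \<Rightarrow> real) measure" where "paths \<equiv> (\<Pi>\<^sub>M i\<in>UNIV. borel)"

text \<open>These are the probabilities w_l of the overview, and \<open>scale\<close> is the
  reciprocal of v_l; both put upward and downward kinds on one index range, so that g_l =
  \<open>weight l / scale l\<close>.\<close>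

definition weight :: "nat \<Rightarrow> real" where
  "weight l = (if l \<le> K then p * k l else q * m (l - K))"

definition scale :: "nat \<Rightarrow> real" where
  "scale l = (if l \<le> K then 1 + a l else 1 + \<beta> (l - K))"

lemma measurable_X [measurable]: "X i \<in> borel_measurable M"
  using indep by (auto simp: indep_vars_def)

lemma measurable_T [measurable]: "T n \<in> borel_measurable M"
  and measurable_C [measurable]: "C n \<in> borel_measurable M"
  and measurable_D [measurable]: "D n \<in> borel_measurable M"
  using measurable_X[of "Gap n"] measurable_X[of "Gain n"] measurable_X[of "Loss n"] by auto

lemma measurable_J [measurable]: "J n \<in> measurable M (count_space UNIV)"
proof -
  have "(\<lambda>\<omega>. nat \<lfloor>X (Kind n) \<omega>\<rfloor>) \<in> measurable M (count_space UNIV)" by measurable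
  then show ?thesis by simp
qed

lemma measurable_into_paths:
  assumes "\<And>i. (\<lambda>z. f z i) \<in> borel_measurable N"
  shows "f \<in> measurable N paths"
  using measurable_PiM_single'[of UNIV "\<lambda>i z. f z i" N "\<lambda>_. borel"] assms by simp

lemma measurable_X_paths [measurable]: "(\<lambda>\<omega> i. X i \<omega>) \<in> measurable M paths"
  by (rule measurable_into_paths) simp

lemma measurable_next_source: "(\<lambda>w i. w (next_source i)) \<in> measurable paths paths"
  by (rule measurable_into_paths) simp

lemma measurable_X_next_source [measurable]: "(\<lambda>\<omega> i. X (next_source i) \<omega>) \<in> measurable M paths"
  by (rule measurable_into_paths) simp

lemma sets_ruinous [measurable]: "Collect (ruinous K a \<beta> x) \<in> sets paths"
proof -
  have "Measurable.pred paths (\<lambda>w. ruinous K a \<beta> x w)" by measurable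
  then show ?thesis by (simp add: pred_def space_PiM)
qed

lemma sum_kinds: "(\<Sum>l=1..K+L. f l) = (\<Sum>l=1..K. f l) + (\<Sum>h=1..L. f (K + h))"
  for f :: "nat \<Rightarrow> 'b::comm_monoid_add"
  using sum.ub_add_nat[of 1 K f L] sum.shift_bounds_cl_nat_ivl[of f 1 K L] by (simp add: add.commute)

lemma kind_cases [consumes 1, case_names up down]:
  assumes "l \<in> {1..K+L}"
  obtains "l \<in> {1..K}" | h where "h \<in> {1..L}" "l = K + h"
  using assms by (cases "l \<le> K") (auto dest: le_Suc_ex simp: not_le less_iff_Suc_add)

lemma weight_nonneg: "l \<in> {1..K+L} \<Longrightarrow> 0 \<le> weight l"
  by (cases l rule: kind_cases) (use k_nonneg m_nonneg pq in \<open>auto simp: weight_def\<close>)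

lemma sum_weight: "(\<Sum>l=1..K+L. weight l) = 1"
  unfolding sum_kinds using k_sum m_sum pq
  by (simp add: weight_def sum_distrib_left[symmetric])

lemma scale_gt_1: "l \<in> {1..K+L} \<Longrightarrow> 1 < scale l"
  by (cases l rule: kind_cases) (use a_pos \<beta>_pos in \<open>auto simp: scale_def\<close>)

lemma prob_kind: "l \<in> {1..K+L} \<Longrightarrow> prob {\<omega> \<in> space M. J n \<omega> = l} = weight l"
  by (cases l rule: kind_cases) (use J_up J_down in \<open>auto simp: weight_def\<close>)

lemma AE_kind: "AE \<omega> in M. J n \<omega> \<in> {1..K+L}"
proof (rule AE_prob_1[of "{\<omega> \<in> space M. J n \<omega> \<in> {1..K+L}}", THEN eventually_mono])
  have "prob {\<omega> \<in> space M. J n \<omega> \<in> {1..K+L}} = prob (\<Union>l\<in>{1..K+L}. {\<omega> \<in> space M. J n \<omega> = l})"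
    by (intro arg_cong[where f = prob]) auto
  also have "\<dots> = (\<Sum>l=1..K+L. prob {\<omega> \<in> space M. J n \<omega> = l})"
    by (intro finite_measure_finite_Union) (auto simp: disjoint_family_on_def)
  also have "\<dots> = 1" by (simp only: prob_kind sum_weight cong: sum.cong)
  finally show "prob {\<omega> \<in> space M. J n \<omega> \<in> {1..K+L}} = 1" .
qed auto

text \<open>The probabilities of the admissible kinds sum to 1, so they determine the whole law, and
  they are the same for every n.\<close>

lemma distr_kind: "distr M borel (X (Kind n)) = distr M borel (X (Kind 0))"
proof -
  have "emeasure (distr M borel (X (Kind n))) A = ennreal (\<Sum>l\<in>{l\<in>{1..K+L}. real l \<in> A}. weight l)"
    if A[measurable]: "A \<in> sets borel" for A n
  proof -
    have "emeasure (distr M borel (X (Kind n))) A = emeasure M {\<omega> \<in> space M. real (J n \<omega>) \<in> A}"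
      by (subst emeasure_distr) (auto intro!: arg_cong[where f = "emeasure M"])
    also have "\<dots> = ennreal (prob {\<omega> \<in> space M. real (J n \<omega>) \<in> A})"
      by (rule emeasure_eq_measure)
    also have "prob {\<omega> \<in> space M. real (J n \<omega>) \<in> A}
        = prob (\<Union>l\<in>{l\<in>{1..K+L}. real l \<in> A}. {\<omega> \<in> space M. J n \<omega> = l})"
      by (intro measure_eq_AE, use AE_kind[of n] in eventually_elim) auto
    also have "\<dots> = (\<Sum>l\<in>{l\<in>{1..K+L}. real l \<in> A}. prob {\<omega> \<in> space M. J n \<omega> = l})"
      by (intro finite_measure_finite_Union) (auto simp: disjoint_family_on_def)
    also have "\<dots> = (\<Sum>l\<in>{l\<in>{1..K+L}. real l \<in> A}. weight l)"
      by (intro sum.cong prob_kind) auto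
    finally show ?thesis .
  qed
  then show ?thesis by (intro measure_eqI) auto
qed

lemma real_distribution_T: "real_distribution (distr M borel (T n))"
  by (simp add: real_distribution_distr)

lemma distr_next_source: "distr M borel (X (next_source i)) = distr M borel (X i)"
proof (cases i)
  case (Gap n)
  then show ?thesis
    using cdf_unique[OF real_distribution_T[of n] real_distribution_T[of "Suc n"]] by (simp add: T_cdf)
next
  case (Kind n)
  then show ?thesis using distr_kind[of n] distr_kind[of "Suc n"] by simp
next
  case (Gain n)
  have "distr M borel (C n) = density lborel (exponential_density \<mu>)" for n
  proof -
    have "distr M borel (C n) = distr M lborel (C n)" by (rule distr_cong) simp_all
    then show ?thesis using distributed_distr_eq_density[OF C_exp[of n]] by simp
  qed
  then show ?thesis by (simp add: Gain)
next
  case (Loss n)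
  have "distr M borel (D n) = density lborel (exponential_density \<nu>)" for n
  proof -
    have "distr M borel (D n) = distr M lborel (D n)" by (rule distr_cong) simp_all
    then show ?thesis using distributed_distr_eq_density[OF D_exp[of n]] by simp
  qed
  then show ?thesis by (simp add: Loss)
qed

definition path_law :: "(source \<Rightarrow> real) measure" where
  "path_law = distr M paths (\<lambda>\<omega> i. X i \<omega>)"

lemma prob_space_path_law: "prob_space path_law"
  unfolding path_law_def by (rule prob_space_distr) measurable

lemma path_law_eq_PiM: "path_law = (\<Pi>\<^sub>M i\<in>UNIV. distr M borel (X i))"
  using indep_vars_iff_distr_eq_PiM[of "UNIV :: source set" X "\<lambda>_. borel"] indep
  by (simp add: path_law_def restrict_UNIV)

lemma sets_path_law [measurable_cong]: "sets path_law = sets paths"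
  by (simp add: path_law_def)

text \<open>By independence the path law is a product measure. Its reindexing along the injective
  shift is again a product, with the same marginals since each type of source is identically
  distributed.\<close>

lemma distr_shifted_path: "distr M paths (\<lambda>\<omega> i. X (next_source i) \<omega>) = path_law"
proof -
  have inj: "inj next_source"
  proof (rule injI)
    fix i j assume "next_source i = next_source j"
    then show "i = j" by (cases i; cases j) auto
  qed
  interpret N: prob_space "distr M borel (X i)" for i by (rule prob_space_distr) simp
  have "distr M paths (\<lambda>\<omega> i. X (next_source i) \<omega>) = distr path_law paths (\<lambda>w i. w (next_source i))"
    unfolding path_law_def by (subst distr_distr) (auto simp: comp_def measurable_next_source)
  also have "\<dots> = distr (\<Pi>\<^sub>M i\<in>UNIV. distr M borel (X i)) (\<Pi>\<^sub>M i\<in>UNIV. distr M borel (X (next_source i)))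
       (\<lambda>w. \<lambda>i\<in>UNIV. w (next_source i))"
    unfolding path_law_eq_PiM by (rule distr_cong) (auto cong: sets_PiM_cong)
  also have "\<dots> = (\<Pi>\<^sub>M i\<in>UNIV. distr M borel (X (next_source i)))"
    by (rule distr_PiM_reindex) (use inj N.prob_space_axioms in auto)
  finally show ?thesis by (simp add: distr_next_source path_law_eq_PiM)
qed

lemma ruin_prob_eq_path_law: "R x = measure path_law {w. ruinous K a \<beta> x w}"
proof -
  have "measure path_law {w. ruinous K a \<beta> x w} = prob {\<omega> \<in> space M. ruinous K a \<beta> x (\<lambda>i. X i \<omega>)}"
    unfolding path_law_def
    by (subst measure_distr) (auto simp: vimage_def Int_def conj_commute space_PiM)
  also have "{\<omega> \<in> space M. ruinous K a \<beta> x (\<lambda>i. X i \<omega>)} = ruin_event M K a \<beta> T J C D x"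
    by (auto simp: mem_ruin_event_iff)
  finally show ?thesis by (simp add: ruin_prob_def)
qed

lemma ruin_prob_eq_integral: "R x = (\<integral>w. (if ruinous K a \<beta> x w then 1 else 0) \<partial>path_law)"
proof -
  interpret PL: prob_space path_law by (rule prob_space_path_law)
  have "R x = (\<integral>w. indicator {w. ruinous K a \<beta> x w} w \<partial>path_law)"
    by (simp add: ruin_prob_eq_path_law sets_path_law)
  then show ?thesis by (simp add: indicator_def of_bool_def)
qed

lemma measurable_ruin_prob [measurable]: "R \<in> borel_measurable borel"
proof -
  interpret PL: prob_space path_law by (rule prob_space_path_law)
  show ?thesis unfolding ruin_prob_eq_integral[abs_def] by measurable
qed

lemma ruin_prob_nonneg: "0 \<le> R x" and ruin_prob_le_1: "R x \<le> 1"
  by (auto simp: ruin_prob_def)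

text \<open>A start at 0 is ruin at time 0. This value accounts for losses that exceed the
  surplus.\<close>

lemma ruin_prob_0: "R 0 = 1"
proof -
  have "prob (ruin_event M K a \<beta> T J C D 0) = prob (space M)"
  proof (rule measure_eq_AE)
    show "AE \<omega> in M. \<omega> \<in> ruin_event M K a \<beta> T J C D 0 \<longleftrightarrow> \<omega> \<in> space M"
      using T_pos[of 0] AE_space
      by eventually_elim (auto simp: mem_ruin_event_iff ruinous_unfold[of _ _ _ 0])
    show "ruin_event M K a \<beta> T J C D 0 \<in> events"
    proof -
      have "ruin_event M K a \<beta> T J C D 0 = {\<omega> \<in> space M. ruinous K a \<beta> 0 (\<lambda>i. X i \<omega>)}"
        by (auto simp: mem_ruin_event_iff)
      also have "\<dots> \<in> events" by measurable
      finally show ?thesis .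
    qed
  qed auto
  then show ?thesis by (simp add: ruin_prob_def prob_space)
qed

text \<open>The sources of the first jump are independent of the shifted path, whose law is again
  the path law. Hence, given the first jump, later ruin has the probability \<open>R\<close> of the
  surplus after it.\<close>

lemma ruin_prob_renewal:
  assumes x: "0 < x"
  shows "R x = expectation (\<lambda>\<omega>. if x \<le> T 0 \<omega> then 1
                 else R (jump K a \<beta> (J 0 \<omega>) (C 0 \<omega>) (D 0 \<omega>) (x - T 0 \<omega>)))"
proof -
  define A where "A = {Gap 0, Kind 0, Gain 0, Loss 0}"
  let ?PA = "\<Pi>\<^sub>M i\<in>A. (borel :: real measure)"
  define V where "V = (\<lambda>\<omega>. \<lambda>i\<in>A. X i \<omega>)"
  define W where "W = (\<lambda>\<omega> i. X (next_source i) \<omega>)"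
  interpret PL: prob_space path_law by (rule prob_space_path_law)
  have [measurable]: "V \<in> measurable M ?PA" unfolding V_def by measurable
  have [measurable]: "W \<in> measurable M paths" unfolding W_def by measurable
  interpret V: prob_space "distr M ?PA V" by (rule prob_space_distr) measurable
  interpret VW: pair_prob_space "distr M ?PA V" path_law ..
  have nA: "next_source i \<notin> A" for i by (cases i) (auto simp: A_def)
  \<comment> \<open>All shifted sources lie outside \<open>A\<close>, so \<open>W\<close> is a
    function of the block complementary to the one that \<open>V\<close> reads.\<close>
  have "indep_var ?PA ((\<lambda>v. v) \<circ> V) paths ((\<lambda>v i. v (next_source i)) \<circ> (\<lambda>\<omega>. \<lambda>i\<in>-A. X i \<omega>))"
    unfolding V_def
    by (rule indep_var_compose[OF indep_var_restrict[OF indep]])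
       (auto intro!: measurable_PiM_single' measurable_component_singleton simp: nA space_PiM)
  moreover have "(\<lambda>v i. v (next_source i)) \<circ> (\<lambda>\<omega>. \<lambda>i\<in>-A. X i \<omega>) = W"
    by (auto simp: fun_eq_iff nA W_def)
  ultimately have "indep_var ?PA V paths W" by (simp add: comp_def)
  then have law: "distr M (?PA \<Otimes>\<^sub>M paths) (\<lambda>\<omega>. (V \<omega>, W \<omega>)) = distr M ?PA V \<Otimes>\<^sub>M path_law"
    unfolding indep_var_distribution_eq distr_shifted_path[folded W_def] by simp
  let ?g = "\<lambda>v w. if x \<le> v (Gap 0) then 1
              else if ruinous K a \<beta> (first_jump K a \<beta> x v) w then 1 else 0 :: real"
  have in_A [simp]: "Gap 0 \<in> A" "Kind 0 \<in> A" "Gain 0 \<in> A" "Loss 0 \<in> A" by (auto simp: A_def)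
  have [measurable]: "(\<lambda>v. v (Gap 0)) \<in> borel_measurable ?PA" "(\<lambda>v. v (Kind 0)) \<in> borel_measurable ?PA"
     "(\<lambda>v. v (Gain 0)) \<in> borel_measurable ?PA" "(\<lambda>v. v (Loss 0)) \<in> borel_measurable ?PA"
    by (auto intro!: measurable_component_singleton)
  have [measurable]: "first_jump K a \<beta> x \<in> borel_measurable ?PA"
    unfolding first_jump_def by measurable
  have [measurable]: "case_prod ?g \<in> borel_measurable (?PA \<Otimes>\<^sub>M paths)"
    by measurable
  have V_simp: "V \<omega> (Gap 0) = T 0 \<omega>"
    "first_jump K a \<beta> x (V \<omega>) = jump K a \<beta> (J 0 \<omega>) (C 0 \<omega>) (D 0 \<omega>) (x - T 0 \<omega>)"
    "first_jump K a \<beta> x (\<lambda>i. X i \<omega>) = first_jump K a \<beta> x (V \<omega>)" for \<omega>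
    by (auto simp: V_def first_jump_def)
  have "R x = (\<integral>w. (if ruinous K a \<beta> x w then 1 else 0) \<partial>path_law)"
    by (rule ruin_prob_eq_integral)
  also have "\<dots> = (\<integral>\<omega>. (if ruinous K a \<beta> x (\<lambda>i. X i \<omega>) then 1 else 0) \<partial>M)"
    unfolding path_law_def by (rule integral_distr) measurable
  also have "\<dots> = (\<integral>\<omega>. case_prod ?g (V \<omega>, W \<omega>) \<partial>M)"
  proof (intro Bochner_Integration.integral_cong refl)
    fix \<omega>
    show "(if ruinous K a \<beta> x (\<lambda>i. X i \<omega>) then 1 else 0) = case_prod ?g (V \<omega>, W \<omega>)"
      using x ruinous_unfold[of K a \<beta> x "\<lambda>i. X i \<omega>"]
      by (auto simp: indicator_def V_simp(1) V_simp(3) W_def)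
  qed
  also have "\<dots> = (\<integral>z. case_prod ?g z \<partial>distr M (?PA \<Otimes>\<^sub>M paths) (\<lambda>\<omega>. (V \<omega>, W \<omega>)))"
    by (rule integral_distr[symmetric]) measurable
  also have "\<dots> = (\<integral>z. case_prod ?g z \<partial>(distr M ?PA V \<Otimes>\<^sub>M path_law))"
    by (simp only: law)
  \<comment> \<open>With the first jump frozen, the inner integral over the path is 1 or
    \<open>R\<close> at the surplus after the jump.\<close>
  also have "\<dots> = (\<integral>v. (\<integral>w. ?g v w \<partial>path_law) \<partial>distr M ?PA V)"
    by (rule VW.integral_fst'[symmetric, of "case_prod ?g", simplified prod.case])
       (rule VW.P.integrable_const_bound[where B = 1]; auto)
  also have "\<dots> = (\<integral>\<omega>. (\<integral>w. ?g (V \<omega>) w \<partial>path_law) \<partial>M)"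
    by (rule integral_distr) measurable
  also have "\<dots> = expectation (\<lambda>\<omega>. if x \<le> T 0 \<omega> then 1
                 else R (jump K a \<beta> (J 0 \<omega>) (C 0 \<omega>) (D 0 \<omega>) (x - T 0 \<omega>)))"
    by (intro Bochner_Integration.integral_cong refl)
       (auto simp: V_simp ruin_prob_eq_integral PL.prob_space)
  finally show ?thesis .
qed

section \<open>Decay of the ruin probability\<close>

text \<open>As there are only finitely many kinds, the largest of the reciprocals v_l is still below
  1; the range of kinds is not empty because the weights sum to 1.\<close>

lemma contraction_ratio:
  obtains r where "0 < r" "r < 1" "\<And>l. l \<in> {1..K+L} \<Longrightarrow> 1 \<le> r * scale l"
proof
  let ?S = "(\<lambda>l. 1 / scale l) ` {1..K+L}"
  have "{1..K+L} \<noteq> {}" using sum_weight by fastforce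
  then have "Max ?S \<in> ?S" by (intro Max_in) auto
  then obtain j where j: "j \<in> {1..K+L}" "Max ?S = 1 / scale j" by auto
  show "0 < Max ?S" "Max ?S < 1" using scale_gt_1[OF j(1)] j(2) by auto
  fix l assume l: "l \<in> {1..K+L}"
  have "1 / scale l \<le> Max ?S" using l by (intro Max_ge) auto
  then show "1 \<le> Max ?S * scale l" using scale_gt_1[OF l] by (simp add: field_simps)
qed

text \<open>One lower bound for both directions: an upward jump is charged a fictitious loss and
  denied its gain, a downward jump is not truncated at 0.\<close>

lemma scale_mult_minus_le_jump:
  "0 \<le> c \<Longrightarrow> 0 \<le> d \<Longrightarrow> scale l * u - d \<le> jump K a \<beta> l c d u"
  by (auto simp: jump_def scale_def)

text \<open>Discount the n-th surplus by r^n. At a positive surplus a jump multiplies by at least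
  1/r, which offsets the additional discounting, so each period costs at most (T_n + D_n) r^n of the
  initial x.\<close>

lemma not_ruin_if_discounted_sum_less:
  assumes r: "0 < r" "r < 1" "\<And>l. l \<in> {1..K+L} \<Longrightarrow> 1 \<le> r * scale l"
    and \<omega>: "\<And>n. 0 \<le> T n \<omega>" "\<And>n. 0 \<le> C n \<omega>" "\<And>n. 0 \<le> D n \<omega>" "\<And>n. J n \<omega> \<in> {1..K+L}"
    and less: "\<And>n. (\<Sum>i\<le>n. (T i \<omega> + D i \<omega>) * r ^ i) < x"
  shows "\<omega> \<notin> ruin_event M K a \<beta> T J C D x"
proof -
  let ?S = "\<lambda>n. surplus_after K a \<beta> T J C D x n \<omega>"
  let ?d = "\<lambda>n. \<Sum>i<n. (T i \<omega> + D i \<omega>) * r ^ i"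
  \<comment> \<open>This excludes ruin before the next jump and also supplies the positive surplus
    before that jump on which the induction step depends.\<close>
  have gap: "T n \<omega> < ?S n" if "x - ?d n \<le> r ^ n * ?S n" for n
  proof -
    have "?d n + (T n \<omega> + D n \<omega>) * r ^ n < x"
      using less[of n] by (simp add: lessThan_Suc_atMost[symmetric])
    moreover have "0 \<le> D n \<omega> * r ^ n" using \<omega>(3)[of n] r by simp
    ultimately have "T n \<omega> * r ^ n < ?S n * r ^ n" using that by (simp add: algebra_simps)
    then show ?thesis using r by simp
  qed
  have lower: "x - ?d n \<le> r ^ n * ?S n" for n
  proof (induction n)
    case 0
    show ?case by simp
  next
    case (Suc n)
    let ?u = "?S n - T n \<omega>"
    have u: "0 < ?u" using gap[OF Suc] by simp
    have "x - ?d (Suc n) \<le> r ^ n * (?u - D n \<omega>)" using Suc by (simp add: algebra_simps)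
    also have "\<dots> \<le> r ^ n * (r * (scale (J n \<omega>) * ?u - D n \<omega>))"
    proof (rule mult_left_mono)
      have "1 * ?u \<le> (r * scale (J n \<omega>)) * ?u"
        using r(3)[OF \<omega>(4)] u by (intro mult_right_mono) auto
      \<comment> \<open>The loss strikes after the scaling and is discounted by r^(n+1); charging it
        at r^n only weakens the bound.\<close>
      moreover have "r * D n \<omega> \<le> 1 * D n \<omega>" using \<omega>(3) r by (intro mult_right_mono) auto
      ultimately show "?u - D n \<omega> \<le> r * (scale (J n \<omega>) * ?u - D n \<omega>)" by (simp add: algebra_simps)
    qed (use r in simp)
    also have "\<dots> \<le> r ^ n * (r * ?S (Suc n))"
      using r \<omega> by (auto intro!: mult_left_mono scale_mult_minus_le_jump)
    finally show ?case by (simp add: mult_ac)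
  qed
  show ?thesis
    using gap[OF lower] by (auto simp: ruin_event_def not_le[symmetric])
qed

lemma expectation_T: "expectation (T n) = expectation (T 0)"
proof (induction n)
  case (Suc n)
  have "expectation (T (Suc n)) = (\<integral>x. x \<partial>distr M borel (X (next_source (Gap n))))"
    by (simp add: integral_distr)
  also have "\<dots> = expectation (T n)"
    unfolding distr_next_source by (simp add: integral_distr)
  finally show ?case using Suc by simp
qed simp

lemma AE_T_nonneg: "AE \<omega> in M. 0 \<le> T n \<omega>"
  using T_pos[of n] by eventually_elim simp

lemma AE_D_nonneg: "AE \<omega> in M. 0 \<le> D n \<omega>" and AE_C_nonneg: "AE \<omega> in M. 0 \<le> C n \<omega>"
  by (rule AE_exponential_nonneg[OF D_exp] AE_exponential_nonneg[OF C_exp])+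

lemma integrable_D: "integrable M (D n)"
  using erlang_ith_moment_integrable[OF \<nu>_pos D_exp[of n], of 1] by simp

text \<open>Markov's inequality for the discounted sum of all gaps and losses, whose mean is the
  geometric series \<tau> / (1 - r).\<close>

lemma ruin_prob_le_inverse:
  obtains c where "\<And>x. 0 < x \<Longrightarrow> R x \<le> c / x"
proof -
  obtain r where r: "0 < r" "r < 1" "\<And>l. l \<in> {1..K+L} \<Longrightarrow> 1 \<le> r * scale l"
    using contraction_ratio by blast
  define \<tau> where "\<tau> = expectation (T 0) + 1 / \<nu>"
  have \<tau>0: "0 \<le> \<tau>"
    using AE_T_nonneg[of 0] \<nu>_pos by (auto simp: \<tau>_def intro!: add_nonneg_nonneg integral_nonneg_AE)
  \<comment> \<open>Summed in the extended nonnegative reals, so that divergent paths need no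
    separate treatment and sum and integral may be interchanged.\<close>
  let ?Y = "\<lambda>\<omega>. \<Sum>i. ennreal ((T i \<omega> + D i \<omega>) * r ^ i)"
  have term_integral: "(\<integral>\<^sup>+\<omega>. ennreal ((T i \<omega> + D i \<omega>) * r ^ i) \<partial>M) = ennreal (\<tau> * r ^ i)" for i
  proof (subst nn_integral_eq_integral)
    show "integrable M (\<lambda>\<omega>. (T i \<omega> + D i \<omega>) * r ^ i)"
      by (intro integrable_mult_left Bochner_Integration.integrable_add T_mean integrable_D)
    show "AE \<omega> in M. 0 \<le> (T i \<omega> + D i \<omega>) * r ^ i"
      using AE_T_nonneg[of i] AE_D_nonneg[of i] by eventually_elim (use r in auto)
    have "expectation (D i) = 1 / \<nu>"
      by (rule exponential_distributed_expectation[OF \<nu>_pos D_exp])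
    then show "ennreal (\<integral>\<omega>. (T i \<omega> + D i \<omega>) * r ^ i \<partial>M) = ennreal (\<tau> * r ^ i)"
      by (simp add: T_mean integrable_D expectation_T[of i] \<tau>_def)
  qed
  have "(\<integral>\<^sup>+\<omega>. ?Y \<omega> \<partial>M) = (\<Sum>i. ennreal (\<tau> * r ^ i))"
    by (subst nn_integral_suminf) (simp_all only: term_integral, measurable)
  also have "\<dots> = ennreal (\<Sum>i. \<tau> * r ^ i)"
    by (rule suminf_ennreal2) (use r \<tau>0 in \<open>auto intro!: summable_mult summable_geometric\<close>)
  also have "(\<Sum>i. \<tau> * r ^ i) = \<tau> / (1 - r)"
    using r by (subst suminf_mult) (auto simp: suminf_geometric summable_geometric)
  finally have Y: "(\<integral>\<^sup>+\<omega>. ?Y \<omega> \<partial>M) = ennreal (\<tau> / (1 - r))" .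
  have "R x \<le> \<tau> / (1 - r) / x" if x: "0 < x" for x
  proof -
    have "AE \<omega> in M. \<forall>n. 0 \<le> T n \<omega> \<and> 0 \<le> C n \<omega> \<and> 0 \<le> D n \<omega> \<and> J n \<omega> \<in> {1..K+L}"
      unfolding AE_all_countable by (intro allI AE_conjI AE_T_nonneg AE_C_nonneg AE_D_nonneg AE_kind)
    then have "AE \<omega> in M. \<omega> \<in> ruin_event M K a \<beta> T J C D x
        \<longrightarrow> \<omega> \<in> {\<omega> \<in> space M. 1 \<le> ennreal (1 / x) * ?Y \<omega>}"
    proof eventually_elim
      case (elim \<omega>)
      show ?case
      proof
        assume ruin: "\<omega> \<in> ruin_event M K a \<beta> T J C D x"
        have "\<not> (\<forall>n. (\<Sum>i\<le>n. (T i \<omega> + D i \<omega>) * r ^ i) < x)"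
          using not_ruin_if_discounted_sum_less[OF r, of \<omega> x] elim ruin by blast
        then obtain n where n: "x \<le> (\<Sum>i\<le>n. (T i \<omega> + D i \<omega>) * r ^ i)" by (auto simp: not_less)
        have "ennreal x \<le> ennreal (\<Sum>i<Suc n. (T i \<omega> + D i \<omega>) * r ^ i)"
          using n by (intro ennreal_leI) (simp only: lessThan_Suc_atMost)
        also have "\<dots> = (\<Sum>i<Suc n. ennreal ((T i \<omega> + D i \<omega>) * r ^ i))"
          by (rule sum_ennreal[symmetric]) (use elim r in auto)
        also have "\<dots> \<le> ?Y \<omega>" by (intro sum_le_suminf) auto
        finally have "ennreal (1 / x) * ennreal x \<le> ennreal (1 / x) * ?Y \<omega>"
          by (rule mult_left_mono) simp
        moreover have "ennreal (1 / x) * ennreal x = 1"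
          using x by (simp add: ennreal_mult[symmetric])
        ultimately show "\<omega> \<in> {\<omega> \<in> space M. 1 \<le> ennreal (1 / x) * ?Y \<omega>}"
          using ruin by (auto simp: ruin_event_def)
      qed
    qed
    then have "emeasure M (ruin_event M K a \<beta> T J C D x) \<le> emeasure M {\<omega> \<in> space M. 1 \<le> ennreal (1 / x) * ?Y \<omega>}"
      by (rule emeasure_mono_AE) measurable
    also have "\<dots> \<le> ennreal (1 / x) * (\<integral>\<^sup>+\<omega>. ?Y \<omega> * indicator (space M) \<omega> \<partial>M)"
      by (rule nn_integral_Markov_inequality) measurable
    also have "(\<integral>\<^sup>+\<omega>. ?Y \<omega> * indicator (space M) \<omega> \<partial>M) = (\<integral>\<^sup>+\<omega>. ?Y \<omega> \<partial>M)"
      by (intro nn_integral_cong) simp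
    also have "ennreal (1 / x) * \<dots> = ennreal (\<tau> / (1 - r) / x)"
      unfolding Y using x r \<tau>0 by (simp add: ennreal_mult[symmetric])
    finally show ?thesis
      unfolding ruin_prob_def using x r \<tau>0 by (simp add: emeasure_eq_measure)
  qed
  then show ?thesis by (rule that)
qed

text \<open>The Stieltjes measure of B is the law of the gaps, as both have the distribution
  function B; restricting it to t >= 0 removes only a null set.\<close>

lemma laplace_stieltjes_eq_expectation:
  "laplace_stieltjes B s = expectation (\<lambda>\<omega>. exp (- (s * of_real (T 0 \<omega>))))"
proof -
  interpret TD: real_distribution "distr M borel (T 0)" by (rule real_distribution_T)
  have B: "\<And>x y. x \<le> y \<Longrightarrow> B x \<le> B y" "\<And>x. continuous (at_right x) B"
      "(B \<longlongrightarrow> 0) at_bot" "(B \<longlongrightarrow> 1) at_top"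
    unfolding T_cdf[of 0, symmetric]
    using TD.cdf_nondecreasing TD.cdf_is_right_cont TD.cdf_lim_at_bot TD.cdf_lim_at_top_prob by auto
  have "interval_measure B = distr M borel (T 0)"
    by (rule cdf_unique[OF real_distribution_interval_measure real_distribution_T])
       (use B in \<open>auto simp: cdf_interval_measure T_cdf\<close>)
  then have "laplace_stieltjes B s = (\<integral>t. indicator {0..} t *\<^sub>R exp (- (s * of_real t)) \<partial>distr M borel (T 0))"
    by (simp add: laplace_stieltjes_def set_lebesgue_integral_def)
  also have "\<dots> = expectation (\<lambda>\<omega>. indicator {0..} (T 0 \<omega>) *\<^sub>R exp (- (s * of_real (T 0 \<omega>))))"
    by (rule integral_distr) measurable
  also have "\<dots> = expectation (\<lambda>\<omega>. exp (- (s * of_real (T 0 \<omega>))))"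
    by (rule integral_cong_AE) (use AE_T_nonneg[of 0] in \<open>auto elim!: eventually_mono\<close>)
  finally show ?thesis .
qed

section \<open>The Laplace transform of the ruin probability\<close>

lemma expectation_indep_triple:
  fixes f g h :: "real \<Rightarrow> complex"
  assumes Z: "Z = Gain 0 \<or> Z = Loss 0"
    and [measurable]: "f \<in> borel_measurable borel" "g \<in> borel_measurable borel" "h \<in> borel_measurable borel"
    and int: "integrable M (\<lambda>\<omega>. f (T 0 \<omega>))" "integrable M (\<lambda>\<omega>. g (real (J 0 \<omega>)))"
      "integrable M (\<lambda>\<omega>. h (X Z \<omega>))"
  shows "integrable M (\<lambda>\<omega>. f (T 0 \<omega>) * g (real (J 0 \<omega>)) * h (X Z \<omega>))" (is ?int)
    and "expectation (\<lambda>\<omega>. f (T 0 \<omega>) * g (real (J 0 \<omega>)) * h (X Z \<omega>))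
       = expectation (\<lambda>\<omega>. f (T 0 \<omega>)) * expectation (\<lambda>\<omega>. g (real (J 0 \<omega>))) * expectation (\<lambda>\<omega>. h (X Z \<omega>))"
      (is ?eq)
proof -
  let ?F = "\<lambda>i. if i = Gap 0 then f else if i = Kind 0 then g else h"
  let ?I = "{Gap 0, Kind 0, Z}"
  have F: "?F i \<in> borel_measurable borel" for i by auto
  have "indep_vars (\<lambda>_. borel) (\<lambda>i \<omega>. ?F i (X i \<omega>)) ?I"
    by (rule indep_vars_compose2[OF indep_vars_subset[OF indep]]) (use F in auto)
  note * = indep_vars_lebesgue_integral[OF _ this] indep_vars_integrable[OF _ this]
  have "integrable M (\<lambda>\<omega>. ?F i (X i \<omega>))" if "i \<in> ?I" for i
    using that int Z by auto
  note * = *[OF _ this]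
  have "Z \<noteq> Gap 0" "Z \<noteq> Kind 0" using Z by auto
  then show ?int ?eq using * by (auto simp: mult.assoc)
qed

definition kind_noise :: "nat \<Rightarrow> source" where
  "kind_noise l = (if l \<le> K then Gain 0 else Loss 0)"

text \<open>A jump of kind \<open>l\<close> depends on only one of gain and loss, so the argument \<open>z\<close> may stand for both.\<close>

definition kind_laplace :: "nat \<Rightarrow> complex \<Rightarrow> real \<Rightarrow> complex" where
  "kind_laplace l s z = laplace_transform (\<lambda>u. R (jump K a \<beta> l z z u)) s"

lemma laplace_jump_eq_kind_laplace:
  "laplace_transform (\<lambda>u. R (jump K a \<beta> l (C 0 \<omega>) (D 0 \<omega>) u)) s = kind_laplace l s (X (kind_noise l) \<omega>)"
  by (auto simp: kind_laplace_def kind_noise_def jump_def)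

lemma measurable_kind_laplace [measurable]: "kind_laplace l s \<in> borel_measurable borel"
  unfolding kind_laplace_def laplace_transform_def set_lebesgue_integral_def by measurable

lemma abs_ruin_prob_le_1: "\<bar>R x\<bar> \<le> 1"
  using ruin_prob_nonneg[of x] ruin_prob_le_1[of x] by simp

lemma norm_kind_laplace_le: "0 < Re s \<Longrightarrow> norm (kind_laplace l s z) \<le> 1 / Re s"
  unfolding kind_laplace_def by (rule norm_laplace_transform_le_1) (auto simp: abs_ruin_prob_le_1)

lemma integrable_exp_T: "0 \<le> Re s \<Longrightarrow> integrable M (\<lambda>\<omega>. exp (- (s * of_real (T 0 \<omega>))))"
  by (rule integrable_const_bound[where B = 1])
     (use AE_T_nonneg[of 0] in \<open>auto elim!: eventually_mono\<close>)

text \<open>The transform in x is taken path by path, where the renewal formula is a delay by the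
  first gap. Gap, kind and noise then stand in separate factors, and independence splits the
  expectation.\<close>

lemma laplace_ruin_prob_renewal:
  assumes s: "0 < Re s"
  shows "laplace_transform R s = (1 - laplace_stieltjes B s) / s + laplace_stieltjes B s *
           (\<Sum>l=1..K+L. of_real (weight l) * expectation (\<lambda>\<omega>. kind_laplace l s (X (kind_noise l) \<omega>)))"
proof -
  let ?e = "\<lambda>\<omega>. exp (- (s * of_real (T 0 \<omega>)))"
  let ?G = "\<lambda>x \<omega>. if x \<le> T 0 \<omega> then 1 else R (jump K a \<beta> (J 0 \<omega>) (C 0 \<omega>) (D 0 \<omega>) (x - T 0 \<omega>))"
  let ?Y = "\<lambda>l \<omega>. ?e \<omega> * (indicator {real l} (real (J 0 \<omega>)) * kind_laplace l s (X (kind_noise l) \<omega>))"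
  have Y: "integrable M (?Y l)" "expectation (?Y l) = laplace_stieltjes B s *
      (of_real (weight l) * expectation (\<lambda>\<omega>. kind_laplace l s (X (kind_noise l) \<omega>)))"
    if l: "l \<in> {1..K+L}" for l
  proof -
    have Z: "kind_noise l = Gain 0 \<or> kind_noise l = Loss 0" by (simp add: kind_noise_def)
    have i2: "integrable M (\<lambda>\<omega>. indicator {real l} (real (J 0 \<omega>)) :: complex)"
      by (rule integrable_const_bound[where B = 1]) (auto simp: indicator_def)
    have i3: "integrable M (\<lambda>\<omega>. kind_laplace l s (X (kind_noise l) \<omega>))"
      by (rule integrable_const_bound[where B = "1 / Re s"]) (auto simp: norm_kind_laplace_le s)
    note * = expectation_indep_triple[OF Z, of "\<lambda>t. exp (- (s * of_real t))" "indicator {real l}"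
        "kind_laplace l s", OF _ _ _ integrable_exp_T i2 i3]
    have "expectation (\<lambda>\<omega>. indicator {real l} (real (J 0 \<omega>)) :: complex)
       = expectation (\<lambda>\<omega>. of_real (indicator {\<omega> \<in> space M. J 0 \<omega> = l} \<omega>))"
      by (intro Bochner_Integration.integral_cong) (auto simp: indicator_def)
    also have "\<dots> = of_real (weight l)"
      by (simp only: integral_complex_of_real, simp add: prob_kind[OF l] Int_def conj_commute)
    finally show "integrable M (?Y l)" "expectation (?Y l) = laplace_stieltjes B s *
      (of_real (weight l) * expectation (\<lambda>\<omega>. kind_laplace l s (X (kind_noise l) \<omega>)))"
      using * s by (simp_all add: laplace_stieltjes_eq_expectation mult.assoc)
  qed
  have "laplace_transform R s = laplace_transform (\<lambda>x. expectation (?G x)) s"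
    by (rule laplace_transform_cong) (rule ruin_prob_renewal)
  also have "\<dots> = expectation (\<lambda>\<omega>. laplace_transform (\<lambda>x. ?G x \<omega>) s)"
    by (rule laplace_transform_expectation[OF s]) (measurable, auto simp: abs_ruin_prob_le_1)
  also have "\<dots> = expectation (\<lambda>\<omega>. (1 - ?e \<omega>) / s + (\<Sum>l=1..K+L. ?Y l \<omega>))"
  proof (rule integral_cong_AE)
    show "(\<lambda>\<omega>. laplace_transform (\<lambda>x. ?G x \<omega>) s) \<in> borel_measurable M"
      unfolding laplace_transform_def set_lebesgue_integral_def by measurable
    show "(\<lambda>\<omega>. (1 - ?e \<omega>) / s + (\<Sum>l=1..K+L. ?Y l \<omega>)) \<in> borel_measurable M"
      by measurable
    show "AE \<omega> in M. laplace_transform (\<lambda>x. ?G x \<omega>) s = (1 - ?e \<omega>) / s + (\<Sum>l=1..K+L. ?Y l \<omega>)"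
      using AE_T_nonneg[of 0] AE_kind[of 0]
    proof eventually_elim
      case (elim \<omega>)
      have "laplace_transform (\<lambda>x. ?G x \<omega>) s
         = (1 - ?e \<omega>) / s + ?e \<omega> * laplace_transform (\<lambda>u. R (jump K a \<beta> (J 0 \<omega>) (C 0 \<omega>) (D 0 \<omega>) u)) s"
        by (rule laplace_transform_delay[OF s elim(1)]) (auto simp: abs_ruin_prob_le_1)
      \<comment> \<open>Exactly one summand survives, since the kind almost surely lies in the index
        range.\<close>
      also have "?e \<omega> * laplace_transform (\<lambda>u. R (jump K a \<beta> (J 0 \<omega>) (C 0 \<omega>) (D 0 \<omega>) u)) s
         = (\<Sum>l=1..K+L. if J 0 \<omega> = l then ?e \<omega> * kind_laplace l s (X (kind_noise l) \<omega>) else 0)"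
        using elim(2) by (subst sum.delta') (auto simp: laplace_jump_eq_kind_laplace)
      also have "\<dots> = (\<Sum>l=1..K+L. ?Y l \<omega>)"
        by (intro sum.cong) (auto simp: indicator_def)
      finally show ?case .
    qed
  qed
  also have "\<dots> = expectation (\<lambda>\<omega>. (1 - ?e \<omega>) / s) + (\<Sum>l=1..K+L. expectation (?Y l))"
    using s Y(1) by (subst Bochner_Integration.integral_add)
      (auto intro!: integrable_exp_T Bochner_Integration.integrable_sum Bochner_Integration.integrable_diff simp: Bochner_Integration.integral_sum)
  also have "expectation (\<lambda>\<omega>. (1 - ?e \<omega>) / s) = (1 - laplace_stieltjes B s) / s"
    using s by (simp add: integrable_exp_T laplace_stieltjes_eq_expectation prob_space)
  also have "(\<Sum>l=1..K+L. expectation (?Y l)) = laplace_stieltjes B s *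
      (\<Sum>l=1..K+L. of_real (weight l) * expectation (\<lambda>\<omega>. kind_laplace l s (X (kind_noise l) \<omega>)))"
    unfolding sum_distrib_left by (intro sum.cong refl Y(2))
  finally show ?thesis .
qed

text \<open>Rescaling the surplus moves the argument from s to z and leaves the factor v_l; the gain
  then contributes F_l and the term in rho(\<mu>).\<close>

lemma expectation_kind_laplace_up:
  assumes s: "0 < Re s" and l: "l \<in> {1..K}" and z: "z = s / of_real (1 + a l)" "z \<noteq> of_real \<mu>"
  shows "expectation (\<lambda>\<omega>. kind_laplace l s (X (kind_noise l) \<omega>))
     = of_real \<mu> / (of_real \<mu> - z) * (laplace_transform R z - laplace_transform R (of_real \<mu>)) / of_real (1 + a l)"
proof -
  have a: "0 < 1 + a l" using a_pos[OF l] by simp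
  have "kind_laplace l s (X (kind_noise l) \<omega>)
      = laplace_transform (\<lambda>u. R (u + C 0 \<omega>)) z / of_real (1 + a l)" for \<omega>
    using l laplace_transform_scale[OF a, of "\<lambda>u. R (u + C 0 \<omega>)" s]
    by (simp add: kind_laplace_def kind_noise_def jump_def z(1))
  moreover have "expectation (\<lambda>\<omega>. laplace_transform (\<lambda>u. R (u + C 0 \<omega>)) z)
      = of_real \<mu> / (of_real \<mu> - z) * (laplace_transform R z - laplace_transform R (of_real \<mu>))"
    using s a z by (intro integral_laplace_exponential_gain prob_space_axioms C_exp \<mu>_pos)
      (auto simp: abs_ruin_prob_le_1 Re_divide_of_real simp del: of_real_add)
  ultimately show ?thesis by simp
qed

lemma expectation_kind_laplace_down:
  assumes s: "0 < Re s" and h: "h \<in> {1..L}" and z: "z = s / of_real (1 + \<beta> h)"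
  shows "expectation (\<lambda>\<omega>. kind_laplace (K + h) s (X (kind_noise (K + h)) \<omega>))
     = of_real \<nu> / (of_real \<nu> + z) * (laplace_transform R z + 1 / of_real \<nu>) / of_real (1 + \<beta> h)"
proof -
  have b: "0 < 1 + \<beta> h" using \<beta>_pos[OF h] by simp
  have "kind_laplace (K + h) s (X (kind_noise (K + h)) \<omega>)
      = laplace_transform (\<lambda>u. R (max (u - D 0 \<omega>) 0)) z / of_real (1 + \<beta> h)" for \<omega>
    using h laplace_transform_scale[OF b, of "\<lambda>u. R (max (u - D 0 \<omega>) 0)" s]
    by (simp add: kind_laplace_def kind_noise_def jump_def z(1))
  moreover have "expectation (\<lambda>\<omega>. laplace_transform (\<lambda>u. R (max (u - D 0 \<omega>) 0)) z)
      = of_real \<nu> / (of_real \<nu> + z) * (laplace_transform R z + 1 / of_real \<nu>)"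
    using s b z by (intro integral_laplace_exponential_loss prob_space_axioms D_exp \<nu>_pos)
      (auto simp: abs_ruin_prob_le_1 ruin_prob_0 Re_divide_of_real simp del: of_real_add)
  ultimately show ?thesis by simp
qed

lemma norm_laplace_stieltjes_le_1: "0 \<le> Re s \<Longrightarrow> norm (laplace_stieltjes B s) \<le> 1"
proof -
  assume s: "0 \<le> Re s"
  have "norm (laplace_stieltjes B s) \<le> expectation (\<lambda>\<omega>. norm (exp (- (s * of_real (T 0 \<omega>)))))"
    unfolding laplace_stieltjes_eq_expectation by (rule integral_norm_bound)
  also have "\<dots> \<le> expectation (\<lambda>\<omega>. 1)"
  proof (rule integral_mono_AE)
    show "AE \<omega> in M. norm (exp (- (s * of_real (T 0 \<omega>)))) \<le> 1"
      using AE_T_nonneg[of 0] by eventually_elim (use s in simp)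
  qed (use s integrable_exp_T in \<open>auto intro: integrable_norm simp del: norm_exp_eq_Re\<close>)
  finally show ?thesis by (simp add: prob_space)
qed

lemma laplace_stieltjes_nonneg_Reals: "laplace_stieltjes B (of_real x) \<in> \<real>\<^sub>\<ge>\<^sub>0"
proof -
  have "laplace_stieltjes B (of_real x) = of_real (expectation (\<lambda>\<omega>. exp (- (x * T 0 \<omega>))))"
    unfolding laplace_stieltjes_eq_expectation integral_complex_of_real[symmetric]
    by (simp add: exp_of_real[symmetric])
  then show ?thesis by simp
qed

end

section \<open>The series for rho and the fixed point at s = \<mu>\<close>

theorem mainTheorem7:
  fixes M :: "'w measure"
    and K L :: nat
    and p q \<mu> \<nu> :: real
    and k m a \<beta> :: "nat \<Rightarrow> real"
    and B :: "real \<Rightarrow> real"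
    and T C D :: "nat \<Rightarrow> 'w \<Rightarrow> real"
    and J :: "nat \<Rightarrow> 'w \<Rightarrow> nat"
    and \<rho> \<phi> :: "complex \<Rightarrow> complex"
    and g :: "nat \<Rightarrow> real"
    and \<zeta> F :: "nat \<Rightarrow> complex \<Rightarrow> complex"
    and gh :: "complex \<Rightarrow> nat \<Rightarrow> complex"
    and \<Lambda> :: "complex \<Rightarrow> complex \<Rightarrow> complex"
    and Z G :: "(nat \<Rightarrow> nat) \<Rightarrow> complex \<Rightarrow> complex"
  assumes model: "dual_risk_model M K L p q k m a \<beta> \<mu> \<nu> B T J C D"
    and \<rho>: "\<rho> = laplace_transform (ruin_prob M K a \<beta> T J C D)"
    and \<phi>: "\<phi> = laplace_stieltjes B"
    and g: "g = (\<lambda>l. if l \<le> K then p * k l / (1 + a l) else q * m (l - K) / (1 + \<beta> (l - K)))"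
    and \<zeta>: "\<zeta> = (\<lambda>l s. if l \<le> K then s / of_real (1 + a l) else s / of_real (1 + \<beta> (l - K)))"
    and F: "F = (\<lambda>l s. if l \<le> K then of_real \<mu> / (of_real \<mu> - \<zeta> l s)
                       else of_real \<nu> / (of_real \<nu> + \<zeta> l s))"
    and gh: "gh = (\<lambda>r l. if l \<le> K then - of_real (g l) * r else of_real (g l / \<nu>))"
    and \<Lambda>: "\<Lambda> = (\<lambda>r s. (1 - \<phi> s) / s + \<phi> s * (\<Sum>l=1..K+L. gh r l * F l s))"
    and Z: "Z = iterate_maps (K + L) \<zeta>"
    and G: "G = G_coeff (K + L) \<phi> \<zeta> F"
  shows
    \<comment> \<open>\<open>gh r\<close> and \<open>\<Lambda> r\<close> are the coefficients and the function L(s) with \<open>r\<close> in the place of \<open>\<rho> \<mu>\<close>\<close>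
    "(\<forall>s. 0 < Re s \<longrightarrow> (\<forall>i. \<forall>l\<in>{1..K}. \<zeta> l (Z i s) \<noteq> of_real \<mu>) \<longrightarrow>
        (\<lambda>n. \<Sum>i\<in>multi_indices (K + L) n.
               (\<Prod>l=1..K+L. of_real (g l) ^ i l) * G i s * \<Lambda> (\<rho> (of_real \<mu>)) (Z i s)) sums \<rho> s)
     \<and> (\<forall>r. (\<lambda>n. \<Sum>i\<in>multi_indices (K + L) n.
               (\<Prod>l=1..K+L. of_real (g l) ^ i l) * G i (of_real \<mu>) * \<Lambda> r (Z i (of_real \<mu>))) sums r
             \<longleftrightarrow> r = \<rho> (of_real \<mu>))"
proof -
  interpret dual_risk_model M K L p q k m a \<beta> \<mu> \<nu> B T J C D by (rule model)
  define N where "N = K + L"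
  obtain r where r: "0 < r" "r < 1" "\<And>l. l \<in> {1..N} \<Longrightarrow> 1 \<le> r * scale l"
    unfolding N_def using contraction_ratio by blast
  define v where "v = (\<lambda>l. 1 / scale l)"
  have v0: "0 < v l" and v1: "v l < 1" and vr: "v l \<le> r" if "l \<in> {1..N}" for l
    using scale_gt_1[of l] r(3)[OF that] that by (auto simp: v_def N_def field_simps)
  have g_eq: "g l = weight l * v l" for l by (simp add: g weight_def v_def scale_def)
  have \<zeta>_eq: "\<zeta> l z = of_real (v l) * z" for l z
    by (simp add: \<zeta> v_def scale_def divide_inverse mult.commute)
  have \<rho>_eq: "\<rho> = laplace_transform R" by (simp add: \<rho>)
  have K_sub: "{1..K} \<subseteq> {1..N}" by (auto simp: N_def)
  have Z_eq: "Z = iterate_maps N \<zeta>" and G_eq: "G = G_coeff N \<phi> \<zeta> F" by (simp_all add: Z G N_def)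
  have Z_scale: "Z i s = of_real (\<Prod>l=1..N. v l ^ i l) * s" for i s
    unfolding Z_eq by (rule iterate_maps_scaling) (rule \<zeta>_eq)
  have v_prod: "0 < (\<Prod>l=1..N. v l ^ i l)" for i by (intro prod_pos ballI zero_less_power v0)
  have Re_Z: "0 < Re (Z i s)" if "0 < Re s" for i s
    using v_prod[of i] that by (subst Z_scale) (simp del: of_real_prod)

  have functional_equation: "\<rho> z = \<Lambda> (\<rho> (of_real \<mu>)) z + \<phi> z * (\<Sum>l=1..N. of_real (weight l * v l) * F l z * \<rho> (\<zeta> l z))"
    if z: "0 < Re z" and ne: "\<And>l. l \<in> {1..K} \<Longrightarrow> \<zeta> l z \<noteq> of_real \<mu>" for z
  proof -
    have "of_real (weight l) * expectation (\<lambda>\<omega>. kind_laplace l z (X (kind_noise l) \<omega>))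
        = gh (\<rho> (of_real \<mu>)) l * F l z + of_real (weight l * v l) * F l z * \<rho> (\<zeta> l z)"
      if "l \<in> {1..N}" for l
      using that unfolding N_def
    proof (cases l rule: kind_cases)
      case up
      have "\<zeta> l z = z / of_real (1 + a l)" using up by (simp add: \<zeta>)
      note E = expectation_kind_laplace_up[OF z up this ne[OF up]]
      have "scale l = 1 + a l" using up by (simp add: scale_def)
      then show ?thesis
        unfolding E using up
        by (simp add: gh g_eq F \<rho>_eq v_def algebra_simps diff_divide_distrib del: of_real_add)
    next
      case (down h)
      have "\<zeta> l z = z / of_real (1 + \<beta> h)" using down by (simp add: \<zeta>)
      note E = expectation_kind_laplace_down[OF z down(1) this]
      have "scale l = 1 + \<beta> h" using down by (simp add: scale_def)
      moreover have "of_real \<nu> / (of_real \<nu> + \<zeta> l z) = F l z" using down by (simp add: F)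
      ultimately show ?thesis
        unfolding E[folded down(2)] using down
        by (simp add: gh g_eq \<rho>_eq v_def distrib_left add_divide_distrib mult_ac del: of_real_add)
          (simp add: distrib_left)
    qed
    then have "(\<Sum>l=1..N. of_real (weight l) * expectation (\<lambda>\<omega>. kind_laplace l z (X (kind_noise l) \<omega>)))
        = (\<Sum>l=1..N. gh (\<rho> (of_real \<mu>)) l * F l z) + (\<Sum>l=1..N. of_real (weight l * v l) * F l z * \<rho> (\<zeta> l z))"
      unfolding sum.distrib[symmetric] by (intro sum.cong refl)
    then show ?thesis
      using laplace_ruin_prob_renewal[OF z]
      by (simp only: \<rho>_eq[symmetric] \<phi>[symmetric] \<Lambda> N_def distrib_left add.assoc)
  qed

  have series: "(\<lambda>n. \<Sum>i\<in>multi_indices (K + L) n. (\<Prod>l=1..K+L. of_real (g l) ^ i l) * G i s *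
      \<Lambda> (\<rho> (of_real \<mu>)) (Z i s)) sums \<rho> s"
    if s: "0 < Re s" and ne: "\<And>i l. l \<in> {1..K} \<Longrightarrow> \<zeta> l (Z i s) \<noteq> of_real \<mu>" for s
  proof -
    obtain c where c: "0 \<le> c" "\<And>n i l. i \<in> multi_indices N n \<Longrightarrow> l \<in> {1..K} \<Longrightarrow>
      norm (of_real \<mu> / (of_real \<mu> - \<zeta> l (iterate_maps N \<zeta> i s))) \<le> 1 + c * r ^ n"
    proof (rule norm_pole_factors_le[of r N v \<zeta> \<mu> "{1..K}" s])
      show "\<And>l. l \<in> {1..N} \<Longrightarrow> 0 \<le> v l" using v0 by (simp add: less_imp_le)
    qed (use r vr \<mu>_pos K_sub ne in \<open>auto simp: \<zeta>_eq Z_eq\<close>)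
    obtain b where b: "\<And>x. 0 < x \<Longrightarrow> R x \<le> b / x" using ruin_prob_le_inverse by blast
    show ?thesis
      unfolding N_def[symmetric] g_eq G_eq Z_eq
    proof (rule iterated_equation_sums[where r = r and c = c])
      fix n i l assume i: "i \<in> multi_indices N n" and l: "l \<in> {1..N}"
      show "norm (F l (iterate_maps N \<zeta> i s)) \<le> 1 + c * r ^ n"
      proof (cases "l \<le> K")
        case True
        then show ?thesis using c(2)[OF i, of l] l by (simp add: F)
      next
        case False
        \<comment> \<open>For downward kinds the pole -\<nu> lies in the left half-plane, so the
          factor has modulus at most 1; the constant \<open>c\<close> is needed for the upward kinds
          alone.\<close>
        let ?z = "\<zeta> l (iterate_maps N \<zeta> i s)"
        have "0 \<le> Re ?z"
          using Re_Z[OF s, of i] v0[OF l] by (simp add: \<zeta>_eq Z_eq)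
        then have "\<nu> \<le> norm (of_real \<nu> + ?z)"
          using complex_Re_le_cmod[of "of_real \<nu> + ?z"] by simp
        then have "\<nu> / norm (of_real \<nu> + ?z) \<le> 1"
          using \<nu>_pos by (subst divide_le_eq_1_pos) linarith+
        then have "norm (F l (iterate_maps N \<zeta> i s)) \<le> 1"
          using False \<nu>_pos by (simp add: F norm_divide)
        also have "1 \<le> 1 + c * r ^ n" using c r by simp
        finally show ?thesis .
      qed
    next
      fix e :: real assume e: "0 < e"
      show "\<exists>\<eta>>0. \<forall>z. 0 < Re z \<longrightarrow> Re z \<le> \<eta> \<longrightarrow> Re z * norm (\<rho> z) \<le> e"
        unfolding \<rho>_eq
        by (rule Re_mult_norm_laplace_transform_small[of R b e])
           (use e b ruin_prob_nonneg ruin_prob_le_1 in auto)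
    next
      fix i
      show "\<rho> (iterate_maps N \<zeta> i s) = \<Lambda> (\<rho> (of_real \<mu>)) (iterate_maps N \<zeta> i s) + \<phi> (iterate_maps N \<zeta> i s) *
       (\<Sum>l=1..N. of_real (weight l * v l) * F l (iterate_maps N \<zeta> i s) * \<rho> (\<zeta> l (iterate_maps N \<zeta> i s)))"
        using ne Re_Z[OF s] by (intro functional_equation) (auto simp: Z_eq)
    qed (use r v0 vr weight_nonneg sum_weight \<zeta>_eq s c norm_laplace_stieltjes_le_1 in \<open>auto simp: N_def \<phi>\<close>)
  qed

  \<comment> \<open>At s = \<mu> every argument of a factor lies strictly between 0 and \<mu>: the
    pole condition holds automatically, and all factors are positive.\<close>
  have below_pole: "of_real (v l) * Z i (of_real \<mu>) = of_real (v l * (\<Prod>l=1..N. v l ^ i l) * \<mu>)"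
      "v l * (\<Prod>l=1..N. v l ^ i l) * \<mu> < \<mu>" "0 < v l * (\<Prod>l=1..N. v l ^ i l) * \<mu>"
    if l: "l \<in> {1..N}" for i l
  proof -
    show "of_real (v l) * Z i (of_real \<mu>) = of_real (v l * (\<Prod>l=1..N. v l ^ i l) * \<mu>)"
      by (simp only: Z_scale of_real_mult mult.assoc)
    show "0 < v l * (\<Prod>l=1..N. v l ^ i l) * \<mu>" by (intro mult_pos_pos v0[OF l] v_prod \<mu>_pos)
    have "(\<Prod>l=1..N. v l ^ i l) \<le> 1"
      by (intro prod_le_1 conjI zero_le_power power_le_one less_imp_le[OF v0] less_imp_le[OF v1])
    then have "v l * (\<Prod>l=1..N. v l ^ i l) \<le> v l * 1"
      using v0[OF l] by (intro mult_left_mono) auto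
    then have "v l * (\<Prod>l=1..N. v l ^ i l) < 1" using v1[OF l] by linarith
    then show "v l * (\<Prod>l=1..N. v l ^ i l) * \<mu> < \<mu>" using \<mu>_pos by simp
  qed
  have series_\<mu>: "(\<lambda>n. \<Sum>i\<in>multi_indices (K + L) n. (\<Prod>l=1..K+L. of_real (g l) ^ i l) * G i (of_real \<mu>) *
      \<Lambda> (\<rho> (of_real \<mu>)) (Z i (of_real \<mu>))) sums \<rho> (of_real \<mu>)"
  proof (rule series)
    fix i l assume "l \<in> {1..K}"
    then have l: "l \<in> {1..N}" using K_sub by auto
    show "\<zeta> l (Z i (of_real \<mu>)) \<noteq> of_real \<mu>"
      unfolding \<zeta>_eq below_pole(1)[OF l] of_real_eq_iff
      using below_pole(2)[OF l, of i] by (rule less_imp_neq)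
  qed (use \<mu>_pos in simp)

  have unique: "r' = \<rho> (of_real \<mu>)"
    if r': "(\<lambda>n. \<Sum>i\<in>multi_indices (K + L) n. (\<Prod>l=1..K+L. of_real (g l) ^ i l) * G i (of_real \<mu>) *
      \<Lambda> r' (Z i (of_real \<mu>))) sums r'" for r'
  proof (rule ccontr)
    assume neq: "r' \<noteq> \<rho> (of_real \<mu>)"
    let ?d = "\<rho> (of_real \<mu>) - r'"
    \<comment> \<open>The negative of the slope of \<open>\<Lambda> r z\<close> in r; downward kinds
      drop out because their \<open>gh\<close> does not involve r.\<close>
    let ?P = "\<lambda>z. \<phi> z * (\<Sum>l=1..K. of_real (g l) * F l z)"
    let ?t = "\<lambda>n. \<Sum>i\<in>multi_indices N n. (\<Prod>l=1..N. of_real (g l) ^ i l) * G i (of_real \<mu>) * ?P (Z i (of_real \<mu>))"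
    have \<Lambda>_diff: "\<Lambda> r' z - \<Lambda> (\<rho> (of_real \<mu>)) z = ?d * ?P z" for z
    proof -
      have "(\<Sum>l=1..K+L. gh r' l * F l z) - (\<Sum>l=1..K+L. gh (\<rho> (of_real \<mu>)) l * F l z) = ?d * (\<Sum>l=1..K. of_real (g l) * F l z)"
        unfolding sum_kinds by (simp add: gh sum_distrib_left sum_subtractf[symmetric] algebra_simps)
      moreover have "\<Lambda> r' z - \<Lambda> (\<rho> (of_real \<mu>)) z
          = \<phi> z * ((\<Sum>l=1..K+L. gh r' l * F l z) - (\<Sum>l=1..K+L. gh (\<rho> (of_real \<mu>)) l * F l z))"
        unfolding \<Lambda> by (simp add: algebra_simps)
      ultimately show ?thesis by (simp only: mult.left_commute)
    qed
    have F_nonneg: "F l (Z i (of_real \<mu>)) \<in> \<real>\<^sub>\<ge>\<^sub>0" if l: "l \<in> {1..N}" for i l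
    proof -
      have "F l (Z i (of_real \<mu>)) = of_real (if l \<le> K then \<mu> / (\<mu> - v l * (\<Prod>l=1..N. v l ^ i l) * \<mu>)
          else \<nu> / (\<nu> + v l * (\<Prod>l=1..N. v l ^ i l) * \<mu>))"
        unfolding F \<zeta>_eq below_pole(1)[OF l] by (simp del: of_real_prod)
      then show ?thesis
        using below_pole(2,3)[OF l, of i] \<mu>_pos \<nu>_pos by (simp only: nonneg_Reals_of_real_iff) simp
    qed
    have \<phi>_nonneg: "\<phi> (Z i (of_real \<mu>)) \<in> \<real>\<^sub>\<ge>\<^sub>0" for i
      unfolding \<phi> Z_scale of_real_mult[symmetric] by (rule laplace_stieltjes_nonneg_Reals)
    have g_nonneg: "0 \<le> g l" if "l \<in> {1..N}" for l
      using weight_nonneg[of l] v0[OF that] that by (simp add: g_eq N_def)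
    have t_nonneg: "?t n \<in> \<real>\<^sub>\<ge>\<^sub>0" for n
    proof (intro sum_nonneg_Reals nonneg_Reals_mult_I)
      fix i assume i: "i \<in> multi_indices N n"
      have "(\<Prod>l=1..N. complex_of_real (g l) ^ i l) = of_real (\<Prod>l=1..N. g l ^ i l)" by simp
      also have "\<dots> \<in> \<real>\<^sub>\<ge>\<^sub>0"
        unfolding nonneg_Reals_of_real_iff by (intro prod_nonneg ballI zero_le_power g_nonneg)
      finally show "(\<Prod>l=1..N. complex_of_real (g l) ^ i l) \<in> \<real>\<^sub>\<ge>\<^sub>0" .
      show "G i (of_real \<mu>) \<in> \<real>\<^sub>\<ge>\<^sub>0"
        unfolding G_eq by (rule G_coeff_nonneg_Reals[OF _ _ i]) (use \<phi>_nonneg F_nonneg in \<open>auto simp: Z_eq\<close>)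
    qed (use \<phi>_nonneg F_nonneg g_nonneg K_sub in auto)
    have "(\<lambda>n. ?d * ?t n) sums (r' - \<rho> (of_real \<mu>))"
    proof -
      have "?d * ?t n = (\<Sum>i\<in>multi_indices (K + L) n. (\<Prod>l=1..K+L. of_real (g l) ^ i l) * G i (of_real \<mu>) *
            \<Lambda> r' (Z i (of_real \<mu>))) - (\<Sum>i\<in>multi_indices (K + L) n. (\<Prod>l=1..K+L. of_real (g l) ^ i l) * G i (of_real \<mu>) *
            \<Lambda> (\<rho> (of_real \<mu>)) (Z i (of_real \<mu>)))" for n
        unfolding sum_subtractf[symmetric] right_diff_distrib[symmetric] \<Lambda>_diff sum_distrib_left N_def
        by (intro sum.cong refl) (simp only: mult_ac)
      then show ?thesis using sums_diff[OF r' series_\<mu>] by (simp only:)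
    qed
    \<comment> \<open>The difference of the two series equals -\<open>?d\<close>, so division by the
      nonzero \<open>?d\<close> makes a series of nonnegative terms sum to -1.\<close>
    then have "(\<lambda>n. ?d * ?t n / ?d) sums ((r' - \<rho> (of_real \<mu>)) / ?d)" by (rule sums_divide)
    moreover have "(r' - \<rho> (of_real \<mu>)) / ?d = - 1" using neq by (simp add: field_simps)
    moreover have "?d * ?t n / ?d = ?t n" for n by (rule nonzero_mult_div_cancel_left) (use neq in simp)
    ultimately have "?t sums (- 1)" by (simp only:)
    then have Re_t: "(\<lambda>n. Re (?t n)) sums Re (- 1)" by (rule sums_Re)
    have "0 \<le> Re (?t n)" for n
      using t_nonneg[of n] unfolding complex_nonneg_Reals_iff by blast
    then have "0 \<le> Re (- 1)" by (rule sums_le[OF _ sums_zero Re_t])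
    then show False by simp
  qed
  show ?thesis
    using series series_\<mu> unique by blast
qed

end
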